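(* Let $\mathcal{A} = \{X_1, \dots, X_k\}$ be a set of real-valued random variables on a common probability space with $a_i \leq X_i \leq b_i$ for real numbers $a_i \le b_i$, $i=1,\dots,k$, and let $r(\mathcal{A}) = \max_{1\leq i \leq k}|b_i-a_i|$. Then (possibly after enlarging the underlying probability space) there exists another set of random variables $\mathcal{A}^\star = \{X_1^\star, \dots, X_k^\star\}$, defined jointly with $X_1,\dots,X_k$, with the following properties: 1. for each $i$, $X_i^\star$ has the same marginal distribution as $X_i$; 2. the variables $X_1^\star,\dots,X_k^\star$ are (mutually) independent; 3. for any $\lambda > 0$, $$\mathbb{P}\Big[\frac{1}{k}\sum_{i=1}^{k}|X_i - X_i^\star| > \lambda\Big] \leq 18\, k\, \vec{\alpha}(\mathcal{A}) \sqrt{\frac{r(\mathcal{A})}{\lambda}}.$$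
   Context: For two sub-$\sigma$-algebras $\mathcal{B},\mathcal{C}$ of a probability space $(\Omega,\mathcal{F},\mathbb{P})$, the $\alpha$-dependence coefficient is $\alpha(\mathcal{B}|\mathcal{C}) = \sup_{B\in\mathcal{B}, C\in\mathcal{C}} |\mathbb{P}[B\cap C] - \mathbb{P}[B]\mathbb{P}[C]|$. For random variables (or families of random variables) $X, Y$, $\alpha(X|Y) = \alpha(\sigma(X)|\sigma(Y))$, where $\sigma(\cdot)$ is the generated $\sigma$-algebra. The $\alpha$-separation coefficient of a set of random variables $\mathcal{A} = \{X_1,\dots,X_k\}$ is $$\vec{\alpha}(\mathcal{A}) = \min_{\pi\in\Pi_k} \frac{1}{k}\sum_{i=1}^{k-1}\alpha\big(X_{\pi(i)} \,\big|\, \{X_{\pi(i+1)},\dots,X_{\pi(k)}\}\big),$$ where $\Pi_k$ is the set of all permutations of $1,\dots,k$. *)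

theory Defs
  imports "HOL-Probability.Probability" "HOL-Combinatorics.Permutations"
begin

definition gen_sigma :: "'a measure \<Rightarrow> ('i \<Rightarrow> 'a \<Rightarrow> real) \<Rightarrow> 'i set \<Rightarrow> 'a set set" where
  "gen_sigma M X I =
     sigma_sets (space M) (\<Union>i\<in>I. {X i -` A \<inter> space M | A. A \<in> sets borel})"

text \<open>In the following definition, the supremum is taken in the conditionally complete order of
  the reals; for a probability measure the values lie in the interval from 0 to 1, and sigma-algebras
  are nonempty, so it is a genuine least upper bound.\<close>

definition alpha_coeff :: "'a measure \<Rightarrow> 'a set set \<Rightarrow> 'a set set \<Rightarrow> real" where
  "alpha_coeff M \<B> \<C> =
     (SUP (B, C) \<in> \<B> \<times> \<C>. \<bar>measure M (B \<inter> C) - measure M B * measure M C\<bar>)"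

definition alpha_sep :: "'a measure \<Rightarrow> nat \<Rightarrow> (nat \<Rightarrow> 'a \<Rightarrow> real) \<Rightarrow> real" where
  "alpha_sep M k X =
     (MIN \<pi> \<in> {\<pi>. \<pi> permutes {1..k}}.
        (1 / real k) *
        (\<Sum>i = 1..<k. alpha_coeff M (gen_sigma M X {\<pi> i}) (gen_sigma M X (\<pi> ` {i+1..k}))))"

text \<open>\<open>enlargement N p M\<close>: the probability space \<open>N\<close> extends \<open>M\<close> via the measure-preserving
  map \<open>p\<close>, so that a random variable \<open>X\<close> on \<open>M\<close> is regarded as the random variable
  \<open>X \<circ> p\<close> on \<open>N\<close>.  As types cannot be quantified existentially, an existence claim has to fix the
  type of \<open>N\<close>; \<open>'a \<times> (nat \<Rightarrow> real)\<close> with \<open>p = fst\<close> has room for countably many auxiliary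
  real random variables.\<close>

definition enlargement :: "'b measure \<Rightarrow> ('b \<Rightarrow> 'a) \<Rightarrow> 'a measure \<Rightarrow> bool" where
  "enlargement N p M \<longleftrightarrow> prob_space N \<and> p \<in> measurable N M \<and> distr N M p = M"

end

theory Submission
  imports Defs
begin

text \<open>
  Every \<open>X i\<close> is coupled with an independent copy so that, at each dyadic scale \<open>r / 2 ^ l\<close>, the two
  values lie in different cells of the dyadic partition of \<open>[a i, a i + r]\<close> with probability of order
  \<open>sqrt (2 ^ l) * \<alpha> i\<close>, where \<open>\<alpha> i\<close> is the dependence coefficient between \<open>X i\<close> and the variables
  after it in an optimal order. Values in the same cell differ by at most \<open>r / 2 ^ l\<close>, so choosing the
  scale \<open>r / 2 ^ l\<close> just below \<open>t\<close> and summing over \<open>i\<close> gives the bound. Three points make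
  this work.

  The factor \<open>sqrt (2 ^ l)\<close>. Let \<open>v j c\<close> be the difference between the joint probability of cell \<open>j\<close>
  and condition \<open>c\<close> and the product of their probabilities. The coefficient \<open>\<alpha>\<close> controls the sums
  of \<open>v\<close> over all rectangles, whereas a coupling needs the sum of \<open>\<bar>v j c\<bar>\<close>. Attaching random signs
  to the \<open>n\<close> cells and using the \<open>L1\<close> Khinchin inequality and Cauchy--Schwarz, one passes from the
  former to the latter at the cost of a factor of order \<open>sqrt n\<close> instead of the trivial \<open>n\<close>
  (\<open>sum_abs_le_of_rectangles\<close>).

  One coupling for all \<open>t\<close>. Maximal couplings for different scales need not be compatible, but dyadic
  partitions are nested. Matching as much mass as possible inside the smallest cells, then inside
  their parents, and so on, is simultaneously optimal at every scale
  (\<open>hierarchical_matching\<close>, \<open>hierarchical_coupling\<close>). Finitely many scales are enough: if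
  the sum of the \<open>\<alpha> i\<close> is positive, the bound exceeds \<open>1\<close> for small \<open>t\<close>, and if it is zero, the
  variables are already independent and serve as their own copies.

  Reduction to finite sets. With a finest scale fixed, only the cells of the variables matter. The
  vector of cells is coupled with a vector of independent cells by peeling off one coordinate at a
  time, conditionally on the cells of the later ones (\<open>coupling_with_independent_list\<close>). This discrete
  coupling is lifted to \<open>M\<close> and the product \<open>Q\<close> of the marginal laws by reweighting
  \<open>M \<Otimes>\<^sub>M Q\<close> with a density that depends on the cells only and preserves both marginals
  (\<open>measure_with_marginals_and_discrete_coupling\<close>). The copies are then the coordinates of the second
  factor, so that they have the right laws and are independent.
\<close>

section \<open>Bounding a matrix by its rectangle sums\<close>

text \<open>
  The random sign of \<open>v j\<close> is \<open>+1\<close> if \<open>j \<in> S\<close> and \<open>-1\<close> otherwise, so that averaging over all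
  signs is summing over \<open>Pow J\<close>.
\<close>

definition signed_sum :: "'b set \<Rightarrow> ('b \<Rightarrow> real) \<Rightarrow> 'b set \<Rightarrow> real" where
  "signed_sum J v S = (\<Sum>j\<in>J. if j \<in> S then v j else - v j)"

lemma sum_Pow_insert:
  assumes "finite F" "x \<notin> F"
  shows "(\<Sum>S\<in>Pow (insert x F). f S) = (\<Sum>S\<in>Pow F. f S + (f (insert x S) :: real))"
proof -
  have inj: "inj_on (insert x) (Pow F)"
    using assms(2) by (auto simp: inj_on_def dest: insert_ident[THEN iffD1, rotated 2])
  have "(\<Sum>S\<in>Pow (insert x F). f S) = sum f (Pow F) + sum f (insert x ` Pow F)"
    unfolding Pow_insert using assms by (intro sum.union_disjoint) auto
  also have "sum f (insert x ` Pow F) = (\<Sum>S\<in>Pow F. f (insert x S))"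
    using inj by (simp add: sum.reindex)
  finally show ?thesis by (simp add: sum.distrib)
qed

lemma signed_sum_insert:
  assumes "finite F" "x \<notin> F" "S \<in> Pow F"
  shows "signed_sum (insert x F) v S = signed_sum F v S - v x"
    and "signed_sum (insert x F) v (insert x S) = signed_sum F v S + v x"
proof -
  have "x \<notin> S" using assms by auto
  then show "signed_sum (insert x F) v S = signed_sum F v S - v x"
    using assms by (simp add: signed_sum_def)
  have "(\<Sum>j\<in>F. if j \<in> insert x S then v j else - v j) = (\<Sum>j\<in>F. if j \<in> S then v j else - v j)"
    using assms by (intro sum.cong) auto
  then show "signed_sum (insert x F) v (insert x S) = signed_sum F v S + v x"
    using assms by (simp add: signed_sum_def)
qed

text \<open>
  The cross terms cancel in pairs of sign vectors that differ in one sign.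
\<close>

lemma signed_sum_second_moment:
  assumes "finite J"
  shows "(\<Sum>S\<in>Pow J. (signed_sum J v S)^2) = 2 ^ card J * (\<Sum>j\<in>J. (v j)^2)"
  using assms
proof (induction J rule: finite_induct)
  case empty
  then show ?case by (simp add: signed_sum_def)
next
  case (insert x F)
  have "(\<Sum>S\<in>Pow (insert x F). (signed_sum (insert x F) v S)^2)
     = (\<Sum>S\<in>Pow F. 2 * (signed_sum F v S)^2 + 2 * (v x)^2)"
    unfolding sum_Pow_insert[OF insert.hyps]
    by (intro sum.cong refl)
       (simp add: signed_sum_insert[OF insert.hyps] power2_eq_square algebra_simps)
  also have "\<dots> = 2 * (2 ^ card F * (\<Sum>j\<in>F. (v j)^2)) + 2 * 2 ^ card F * (v x)^2"
    unfolding insert.IH[symmetric]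
    using insert.hyps by (simp add: sum.distrib sum_distrib_left card_Pow)
  finally show ?case using insert.hyps by (simp add: algebra_simps)
qed

text \<open>
  Adding an entry \<open>x\<close> to a signed sum \<open>z\<close> replaces \<open>z^4\<close> by \<open>z^4 + 6 x^2 z^2 + x^4\<close>, the average of
  \<open>(z + x)^4\<close> and \<open>(z - x)^4\<close>. Averaged over the other signs this is at most
  \<open>3 s^2 + 6 x^2 s + x^4 \<le> 3 (s + x^2)^2\<close>, where \<open>s\<close> is the sum of the squares of the other entries.
\<close>

lemma signed_sum_fourth_moment:
  assumes "finite J"
  shows "(\<Sum>S\<in>Pow J. (signed_sum J v S)^4) \<le> 3 * 2 ^ card J * (\<Sum>j\<in>J. (v j)^2)^2"
  using assms
proof (induction J rule: finite_induct)
  case empty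
  then show ?case by (simp add: signed_sum_def)
next
  case (insert x F)
  define s where "s = (\<Sum>j\<in>F. (v j)^2)"
  have "(\<Sum>S\<in>Pow (insert x F). (signed_sum (insert x F) v S)^4)
     = (\<Sum>S\<in>Pow F. 2 * (signed_sum F v S)^4 + 12 * (v x)^2 * (signed_sum F v S)^2 + 2 * (v x)^4)"
    unfolding sum_Pow_insert[OF insert.hyps]
    by (intro sum.cong refl)
       (simp add: signed_sum_insert[OF insert.hyps] power2_eq_square power4_eq_xxxx algebra_simps)
  also have "\<dots> = 2 * (\<Sum>S\<in>Pow F. (signed_sum F v S)^4) + 12 * (v x)^2 * (2 ^ card F * s)
      + 2 ^ card F * (2 * (v x)^4)"
    unfolding s_def signed_sum_second_moment[OF insert.hyps(1), symmetric]
    using insert.hyps by (simp add: sum.distrib sum_distrib_left card_Pow)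
  also have "\<dots> \<le> 2 * (3 * 2 ^ card F * s^2) + 12 * (v x)^2 * (2 ^ card F * s)
      + 2 ^ card F * (6 * (v x)^4)"
    using insert.IH unfolding s_def by (intro add_mono mult_left_mono) auto
  also have "\<dots> = 3 * 2 ^ card (insert x F) * (s + (v x)^2)^2"
    using insert.hyps by (simp add: power2_eq_square power4_eq_xxxx algebra_simps)
  finally show ?case using insert.hyps by (simp add: s_def add.commute)
qed

text \<open>
  With \<open>u = \<bar>z\<bar> / t\<close> the claim is \<open>u * (u - 1)^2 * (u + 2) \<ge> 0\<close>. It bounds a first moment from below by
  the second and fourth moments.
\<close>

lemma abs_ge_quartic:
  fixes z t :: real
  assumes "t > 0"
  shows "\<bar>z\<bar> \<ge> (3 * z^2 / t - z^4 / t^3) / 2"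
proof -
  define u where "u = \<bar>z\<bar> / t"
  have u: "u \<ge> 0" "\<bar>z\<bar> = u * t" using assms by (auto simp: u_def)
  have "2 * u - 3 * u^2 + u^4 = u * (u - 1)^2 * (u + 2)"
    by (simp add: power2_eq_square power4_eq_xxxx algebra_simps)
  also have "\<dots> \<ge> 0" using u by simp
  finally have *: "(3 * u^2 - u^4) / 2 \<le> u" by simp
  have "z^2 = (u*t)^2" "z^4 = (u*t)^4"
    by (simp_all flip: u(2))
  then have "(3 * z^2 / t - z^4 / t^3) / 2 = t * ((3 * u^2 - u^4) / 2)"
    using assms by (simp add: field_simps power2_eq_square power3_eq_cube power4_eq_xxxx)
  also have "\<dots> \<le> t * u" using * assms by (intro mult_left_mono) auto
  finally show ?thesis using u by (simp add: mult.commute)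
qed

text \<open>
  The \<open>L1\<close> Khinchin inequality with constant \<open>1 / sqrt 3\<close>. Averaging the bound
  \<open>abs_ge_quartic\<close> over all signs gives \<open>(3 s^2 / t - 3 s^4 / t^3) / 2\<close> with \<open>s\<close> the Euclidean norm, and
  \<open>t = sqrt 3 * s\<close> maximizes this.
\<close>

lemma khinchin_L1:
  assumes "finite J"
  shows "2 ^ card J * sqrt (\<Sum>j\<in>J. (v j)^2) \<le> sqrt 3 * (\<Sum>S\<in>Pow J. \<bar>signed_sum J v S\<bar>)"
proof -
  define s where "s = sqrt (\<Sum>j\<in>J. (v j)^2)"
  have s2: "s^2 = (\<Sum>j\<in>J. (v j)^2)" by (simp add: s_def sum_nonneg)
  show ?thesis
  proof (cases "s = 0")
    case True
    then show ?thesis by (simp add: s_def sum_nonneg)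
  next
    case False
    then have "s > 0" unfolding s_def by (simp add: sum_nonneg less_le)
    \<comment> \<open>The maximum point of \<open>3 * s^2 / t - 3 * s^4 / t^3\<close>.\<close>
    define t where "t = sqrt 3 * s"
    have t: "t > 0" "t^2 = 3 * s^2" using \<open>s > 0\<close> by (auto simp: t_def power_mult_distrib)
    have "2 ^ card J * (s / sqrt 3) = 2 ^ card J * ((3 * s^2 / t - 3 * s^4 / t^3) / 2)"
    proof -
      have "sqrt 3 * sqrt 3 = (3::real)" by simp
      then have "(3 * s^2 / t - 3 * s^4 / t^3) / 2 = s / sqrt 3"
        using \<open>s > 0\<close>
        by (simp add: t_def field_simps power2_eq_square power3_eq_cube power4_eq_xxxx)
      then show ?thesis by simp
    qed
    also have "\<dots> = (3 * (2 ^ card J * s^2) / t - 3 * 2 ^ card J * (s^2)^2 / t^3) / 2"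
      by (simp add: field_simps)
    also have "\<dots> \<le> (3 * (\<Sum>S\<in>Pow J. (signed_sum J v S)^2) / t
        - (\<Sum>S\<in>Pow J. (signed_sum J v S)^4) / t^3) / 2"
      unfolding signed_sum_second_moment[OF assms] s2
      using signed_sum_fourth_moment[OF assms, of v] t
      by (intro divide_right_mono diff_mono) auto
    also have "\<dots> = (\<Sum>S\<in>Pow J. (3 * (signed_sum J v S)^2 / t - (signed_sum J v S)^4 / t^3) / 2)"
      by (simp only: sum_subtractf sum_divide_distrib[symmetric] sum_distrib_left[symmetric])
    also have "\<dots> \<le> (\<Sum>S\<in>Pow J. \<bar>signed_sum J v S\<bar>)"
      using t by (intro sum_mono abs_ge_quartic)
    finally show ?thesis by (simp add: s_def field_simps)
  qed
qed

text \<open>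
  For fixed signs the absolute sum over \<open>c\<close> splits into four rectangles: \<open>j\<close> in \<open>S\<close> or not, and \<open>c\<close>
  with nonnegative or negative signed sum. This gives the bound \<open>4 * \<alpha>\<close> for every choice of signs, hence
  for their average, which Khinchin's inequality compares with the Euclidean norms of the columns.
  The factor \<open>sqrt (card J)\<close> comes from comparing the Euclidean with the absolute norm.
\<close>

lemma sum_abs_le_of_rectangles:
  fixes v :: "'b \<Rightarrow> 'c \<Rightarrow> real"
  assumes "finite J" "finite C"
    and rect: "\<And>S T. S \<subseteq> J \<Longrightarrow> T \<subseteq> C \<Longrightarrow> \<bar>\<Sum>j\<in>S. \<Sum>c\<in>T. v j c\<bar> \<le> \<alpha>"
  shows "(\<Sum>c\<in>C. \<Sum>j\<in>J. \<bar>v j c\<bar>) \<le> 4 * sqrt 3 * sqrt (card J) * \<alpha>"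
proof -
  have signed: "(\<Sum>c\<in>C. \<bar>signed_sum J (\<lambda>j. v j c) S\<bar>) \<le> 4 * \<alpha>" if S: "S \<subseteq> J" for S
  proof -
    \<comment> \<open>On \<open>T\<close> the absolute value is the signed sum itself, off \<open>T\<close> its negative.\<close>
    define T where "T = {c\<in>C. signed_sum J (\<lambda>j. v j c) S \<ge> 0}"
    have T: "T \<subseteq> C" "finite T" using assms by (auto simp: T_def)
    have split: "(\<Sum>c\<in>U. signed_sum J (\<lambda>j. v j c) S)
        = (\<Sum>j\<in>S. \<Sum>c\<in>U. v j c) - (\<Sum>j\<in>J-S. \<Sum>c\<in>U. v j c)" for U
    proof -
      have "signed_sum J (\<lambda>j. v j c) S = (\<Sum>j\<in>S. v j c) - (\<Sum>j\<in>J-S. v j c)" for c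
      proof -
        have "signed_sum J (\<lambda>j. v j c) S
           = (\<Sum>j\<in>J-S. if j \<in> S then v j c else - v j c) + (\<Sum>j\<in>S. if j \<in> S then v j c else - v j c)"
          unfolding signed_sum_def by (rule sum.subset_diff[OF S assms(1)])
        also have "\<dots> = (\<Sum>j\<in>J-S. - v j c) + (\<Sum>j\<in>S. v j c)"
          by (intro arg_cong2[where f="(+)"] sum.cong) auto
        finally show ?thesis by (simp add: sum_negf)
      qed
      then have "(\<Sum>c\<in>U. signed_sum J (\<lambda>j. v j c) S)
          = (\<Sum>c\<in>U. \<Sum>j\<in>S. v j c) - (\<Sum>c\<in>U. \<Sum>j\<in>J-S. v j c)"
        by (simp add: sum_subtractf)
      then show ?thesis by (simp add: sum.swap[of _ U])
    qed
    have "(\<Sum>c\<in>C. \<bar>signed_sum J (\<lambda>j. v j c) S\<bar>)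
        = (\<Sum>c\<in>C-T. \<bar>signed_sum J (\<lambda>j. v j c) S\<bar>) + (\<Sum>c\<in>T. \<bar>signed_sum J (\<lambda>j. v j c) S\<bar>)"
      by (rule sum.subset_diff[OF T(1) assms(2)])
    also have "\<dots> = - (\<Sum>c\<in>C-T. signed_sum J (\<lambda>j. v j c) S) + (\<Sum>c\<in>T. signed_sum J (\<lambda>j. v j c) S)"
      unfolding sum_negf[symmetric]
      by (intro arg_cong2[where f="(+)"] sum.cong) (auto simp: T_def)
    also have "\<dots> \<le> 4 * \<alpha>"
      unfolding split using rect[of S T] rect[of "J-S" T] rect[of S "C-T"] rect[of "J-S" "C-T"] S T(1)
      by auto
    finally show ?thesis .
  qed
  have cs: "(\<Sum>j\<in>J. \<bar>v j c\<bar>) \<le> sqrt (card J) * sqrt (\<Sum>j\<in>J. (v j c)^2)" for c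
    using L2_set_mult_ineq[of "\<lambda>_. 1" "\<lambda>j. v j c" J]
    by (simp add: L2_set_def)
  have "2 ^ card J * (\<Sum>c\<in>C. sqrt (\<Sum>j\<in>J. (v j c)^2))
      \<le> (\<Sum>c\<in>C. sqrt 3 * (\<Sum>S\<in>Pow J. \<bar>signed_sum J (\<lambda>j. v j c) S\<bar>))"
    unfolding sum_distrib_left by (intro sum_mono khinchin_L1[OF assms(1), unfolded sum_distrib_left])
  also have "\<dots> = sqrt 3 * (\<Sum>S\<in>Pow J. \<Sum>c\<in>C. \<bar>signed_sum J (\<lambda>j. v j c) S\<bar>)"
    by (simp add: sum_distrib_left sum.swap[of _ C])
  also have "\<dots> \<le> sqrt 3 * (\<Sum>S\<in>Pow J. 4 * \<alpha>)"
    using signed by (intro mult_left_mono sum_mono) auto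
  also have "\<dots> = 2 ^ card J * (4 * sqrt 3 * \<alpha>)"
    using assms(1) by (simp add: card_Pow)
  finally have *: "(\<Sum>c\<in>C. sqrt (\<Sum>j\<in>J. (v j c)^2)) \<le> 4 * sqrt 3 * \<alpha>" by simp
  have "(\<Sum>c\<in>C. \<Sum>j\<in>J. \<bar>v j c\<bar>) \<le> sqrt (card J) * (\<Sum>c\<in>C. sqrt (\<Sum>j\<in>J. (v j c)^2))"
    unfolding sum_distrib_left by (intro sum_mono cs)
  also have "\<dots> \<le> sqrt (card J) * (4 * sqrt 3 * \<alpha>)"
    using * by (intro mult_left_mono) auto
  finally show ?thesis by (simp add: mult_ac)
qed

section \<open>Greedy matching along nested partitions\<close>

text \<open>
  A partial matching \<open>\<gamma>\<close> of \<open>\<mu>\<close> with \<open>\<nu>\<close> inside the cells of \<open>h\<close> can be enlarged until, in each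
  cell, one of the two sides is exhausted. If \<open>u\<close> and \<open>v\<close> are the unmatched parts with masses \<open>U\<close> and \<open>V\<close>
  in a cell, adding \<open>u i * v j / max U V\<close> there uses up the smaller of the two and no more than all of
  the larger.
\<close>

lemma greedy_matching_step:
  fixes \<mu> \<nu> :: "'b \<Rightarrow> real" and \<gamma> :: "'b \<Rightarrow> 'b \<Rightarrow> real" and h :: "'b \<Rightarrow> 'c"
  assumes "finite J"
    and nonneg: "\<And>i j. 0 \<le> \<gamma> i j"
    and rows: "\<And>i. i \<in> J \<Longrightarrow> (\<Sum>j\<in>J. \<gamma> i j) \<le> \<mu> i"
    and cols: "\<And>j. j \<in> J \<Longrightarrow> (\<Sum>i\<in>J. \<gamma> i j) \<le> \<nu> j"
    and supp: "\<And>i j. \<gamma> i j \<noteq> 0 \<Longrightarrow> h i = h j"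
  shows "\<exists>\<gamma>'. (\<forall>i j. \<gamma> i j \<le> \<gamma>' i j) \<and> (\<forall>i j. 0 \<le> \<gamma>' i j) \<and>
    (\<forall>i\<in>J. (\<Sum>j\<in>J. \<gamma>' i j) \<le> \<mu> i) \<and> (\<forall>j\<in>J. (\<Sum>i\<in>J. \<gamma>' i j) \<le> \<nu> j) \<and>
    (\<forall>i j. \<gamma>' i j \<noteq> 0 \<longrightarrow> h i = h j) \<and>
    (\<Sum>i\<in>J. \<Sum>j\<in>J. \<gamma>' i j)
      = (\<Sum>A\<in>h ` J. min (\<Sum>i | i \<in> J \<and> h i = A. \<mu> i) (\<Sum>j | j \<in> J \<and> h j = A. \<nu> j))"
proof -
  define cell where "cell A = {i \<in> J. h i = A}" for A
  define u where "u i = \<mu> i - (\<Sum>j\<in>J. \<gamma> i j)" for i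
  define v where "v j = \<nu> j - (\<Sum>i\<in>J. \<gamma> i j)" for j
  define U where "U A = (\<Sum>i\<in>cell A. u i)" for A
  define V where "V A = (\<Sum>j\<in>cell A. v j)" for A
  define \<delta> where "\<delta> i j =
    (if i \<in> J \<and> j \<in> J \<and> h i = h j then u i * v j / max (U (h i)) (V (h i)) else 0)" for i j
  have fin: "finite (cell A)" for A using assms(1) by (simp add: cell_def)
  have u: "0 \<le> u i" if "i \<in> J" for i using rows[OF that] by (simp add: u_def)
  have v: "0 \<le> v j" if "j \<in> J" for j using cols[OF that] by (simp add: v_def)
  have UV: "0 \<le> U A" "0 \<le> V A" for A
    using u v by (auto simp: U_def V_def cell_def intro!: sum_nonneg)
  have \<delta>_nonneg: "0 \<le> \<delta> i j" for i j
    using u v UV by (auto simp: \<delta>_def le_max_iff_disj intro!: divide_nonneg_nonneg)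
  have row: "(\<Sum>j\<in>J. \<delta> i j) = u i * (V (h i) / max (U (h i)) (V (h i)))" if "i \<in> J" for i
  proof -
    have "(\<Sum>j\<in>J. \<delta> i j) = (\<Sum>j\<in>cell (h i). u i * v j / max (U (h i)) (V (h i)))"
      using assms(1) that by (intro sum.mono_neutral_cong_right) (auto simp: cell_def \<delta>_def)
    then show ?thesis by (simp add: V_def sum_distrib_left sum_divide_distrib)
  qed
  have col: "(\<Sum>i\<in>J. \<delta> i j) = v j * (U (h j) / max (U (h j)) (V (h j)))" if "j \<in> J" for j
  proof -
    have "(\<Sum>i\<in>J. \<delta> i j) = (\<Sum>i\<in>cell (h j). v j * u i / max (U (h j)) (V (h j)))"
      using assms(1) that by (intro sum.mono_neutral_cong_right) (auto simp: cell_def \<delta>_def)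
    then show ?thesis by (simp add: U_def sum_distrib_left sum_divide_distrib)
  qed
  have frac: "x / max x y \<le> 1" "y / max x y \<le> 1" if "0 \<le> x" "0 \<le> y" for x y :: real
    using that by (auto simp: divide_le_eq_1 max_def)
  have row_le: "(\<Sum>j\<in>J. \<delta> i j) \<le> u i" if "i \<in> J" for i
    unfolding row[OF that] using mult_left_mono[OF frac(2)[OF UV] u[OF that]] by simp
  have col_le: "(\<Sum>i\<in>J. \<delta> i j) \<le> v j" if "j \<in> J" for j
    unfolding col[OF that] using mult_left_mono[OF frac(1)[OF UV] v[OF that]] by simp
  have by_cells: "(\<Sum>i\<in>J. f i) = (\<Sum>A\<in>h ` J. \<Sum>i\<in>cell A. f i)" for f :: "'b \<Rightarrow> real"
    unfolding cell_def using assms(1) by (rule sum.image_gen)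
  have cell_mass: "(\<Sum>i\<in>J. \<Sum>j\<in>J. \<delta> i j) = (\<Sum>A\<in>h ` J. min (U A) (V A))"
  proof -
    have "(\<Sum>i\<in>cell A. \<Sum>j\<in>J. \<delta> i j) = min (U A) (V A)" for A
    proof -
      have "(\<Sum>i\<in>cell A. \<Sum>j\<in>J. \<delta> i j) = (\<Sum>i\<in>cell A. u i * (V A / max (U A) (V A)))"
        by (intro sum.cong refl) (auto simp: cell_def row)
      also have "\<dots> = U A * (V A / max (U A) (V A))" unfolding U_def by (rule sum_distrib_right[symmetric])
      also have "\<dots> = min (U A) (V A)" using UV[of A] by (auto simp: max_def min_def)
      finally show ?thesis .
    qed
    then show ?thesis by (simp add: by_cells)
  qed
  \<comment> \<open>Since \<open>\<gamma>\<close> never moves mass between cells, it uses the same mass of \<open>\<mu>\<close> and \<open>\<nu>\<close> in each cell.\<close>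
  define g where "g A = (\<Sum>i\<in>cell A. \<Sum>j\<in>J. \<gamma> i j)" for A
  have restrict: "(\<Sum>j\<in>J. \<gamma> i j) = (\<Sum>j\<in>cell A. \<gamma> i j)" "(\<Sum>j\<in>J. \<gamma> j i) = (\<Sum>j\<in>cell A. \<gamma> j i)"
    if "i \<in> cell A" for i A
    using assms(1) that supp by (auto intro!: sum.mono_neutral_right simp: cell_def)
  have g2: "g A = (\<Sum>j\<in>cell A. \<Sum>i\<in>J. \<gamma> i j)" for A
    unfolding g_def by (simp add: restrict cong: sum.cong) (rule sum.swap)
  have "U A = (\<Sum>i\<in>cell A. \<mu> i) - g A" "V A = (\<Sum>j\<in>cell A. \<nu> j) - g A" for A
    unfolding U_def V_def u_def v_def sum_subtractf by (simp add: g_def, simp add: g2)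
  then have "g A + min (U A) (V A) = min (\<Sum>i\<in>cell A. \<mu> i) (\<Sum>j\<in>cell A. \<nu> j)" for A
    by (simp add: min_def)
  then have "(\<Sum>i\<in>J. \<Sum>j\<in>J. \<gamma> i j + \<delta> i j)
      = (\<Sum>A\<in>h ` J. min (\<Sum>i\<in>cell A. \<mu> i) (\<Sum>j\<in>cell A. \<nu> j))"
    unfolding sum.distrib cell_mass by (simp add: by_cells g_def sum.distrib[symmetric])
  then show ?thesis
    using nonneg \<delta>_nonneg row_le col_le supp
    by (intro exI[of _ "\<lambda>i j. \<gamma> i j + \<delta> i j"])
       (auto simp: sum.distrib u_def v_def cell_def add_nonneg_nonneg le_diff_eq add.commute
         split: if_splits simp: \<delta>_def)
qed

text \<open>
  The greedy step is applied to coarser and coarser partitions. Each step only adds mass, so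
  the overlap reached in the partition \<open>h m\<close> is not lost later, although it was the largest possible
  one there: a single matching is optimal for all the partitions.
\<close>

lemma hierarchical_matching:
  fixes \<mu> \<nu> :: "'b \<Rightarrow> real" and h :: "nat \<Rightarrow> 'b \<Rightarrow> 'c"
  assumes "finite J"
    and "\<And>i. i \<in> J \<Longrightarrow> 0 \<le> \<mu> i" "\<And>i. i \<in> J \<Longrightarrow> 0 \<le> \<nu> i"
    and coarser: "\<forall>m i j. h m i = h m j \<longrightarrow> h (Suc m) i = h (Suc m) j"
  shows "\<exists>\<gamma>. (\<forall>i j. 0 \<le> \<gamma> i j) \<and>
    (\<forall>i\<in>J. (\<Sum>j\<in>J. \<gamma> i j) \<le> \<mu> i) \<and> (\<forall>j\<in>J. (\<Sum>i\<in>J. \<gamma> i j) \<le> \<nu> j) \<and>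
    (\<forall>i j. \<gamma> i j \<noteq> 0 \<longrightarrow> h L i = h L j) \<and>
    (\<forall>m\<le>L. (\<Sum>A\<in>h m ` J. min (\<Sum>i | i \<in> J \<and> h m i = A. \<mu> i) (\<Sum>j | j \<in> J \<and> h m j = A. \<nu> j))
        \<le> (\<Sum>i\<in>J. \<Sum>j\<in>J. if h m i = h m j then \<gamma> i j else 0)) \<and>
    (\<Sum>i\<in>J. \<Sum>j\<in>J. \<gamma> i j)
      = (\<Sum>A\<in>h L ` J. min (\<Sum>i | i \<in> J \<and> h L i = A. \<mu> i) (\<Sum>j | j \<in> J \<and> h L j = A. \<nu> j))"
proof (induction L)
  case 0
  from greedy_matching_step[of J "\<lambda>_ _. 0" \<mu> \<nu> "h 0"] assms(1-3)
  obtain \<gamma> where \<gamma>: "\<forall>i j. 0 \<le> \<gamma> i j" "\<forall>i\<in>J. (\<Sum>j\<in>J. \<gamma> i j) \<le> \<mu> i"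
    "\<forall>j\<in>J. (\<Sum>i\<in>J. \<gamma> i j) \<le> \<nu> j" "\<forall>i j. \<gamma> i j \<noteq> 0 \<longrightarrow> h 0 i = h 0 j"
    "(\<Sum>i\<in>J. \<Sum>j\<in>J. \<gamma> i j)
      = (\<Sum>A\<in>h 0 ` J. min (\<Sum>i | i \<in> J \<and> h 0 i = A. \<mu> i) (\<Sum>j | j \<in> J \<and> h 0 j = A. \<nu> j))"
    by auto
  have "(\<Sum>i\<in>J. \<Sum>j\<in>J. if h 0 i = h 0 j then \<gamma> i j else 0) = (\<Sum>i\<in>J. \<Sum>j\<in>J. \<gamma> i j)"
    using \<gamma>(4) by (intro sum.cong refl) auto
  then show ?case using \<gamma> by (intro exI[of _ \<gamma>]) auto
next
  case (Suc L)
  then obtain \<gamma> where \<gamma>: "\<And>i j. 0 \<le> \<gamma> i j" "\<And>i. i \<in> J \<Longrightarrow> (\<Sum>j\<in>J. \<gamma> i j) \<le> \<mu> i"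
    "\<And>j. j \<in> J \<Longrightarrow> (\<Sum>i\<in>J. \<gamma> i j) \<le> \<nu> j" "\<And>i j. \<gamma> i j \<noteq> 0 \<Longrightarrow> h L i = h L j"
    "\<And>m. m \<le> L \<Longrightarrow>
      (\<Sum>A\<in>h m ` J. min (\<Sum>i | i \<in> J \<and> h m i = A. \<mu> i) (\<Sum>j | j \<in> J \<and> h m j = A. \<nu> j))
        \<le> (\<Sum>i\<in>J. \<Sum>j\<in>J. if h m i = h m j then \<gamma> i j else 0)"
    by blast
  have "\<gamma> i j \<noteq> 0 \<Longrightarrow> h (Suc L) i = h (Suc L) j" for i j
    using \<gamma>(4) coarser by blast
  from greedy_matching_step[of J \<gamma> \<mu> \<nu> "h (Suc L)", OF assms(1) \<gamma>(1-3) this]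
  obtain \<gamma>' where \<gamma>': "\<forall>i j. \<gamma> i j \<le> \<gamma>' i j" "\<forall>i j. 0 \<le> \<gamma>' i j"
    "\<forall>i\<in>J. (\<Sum>j\<in>J. \<gamma>' i j) \<le> \<mu> i"
    "\<forall>j\<in>J. (\<Sum>i\<in>J. \<gamma>' i j) \<le> \<nu> j" "\<forall>i j. \<gamma>' i j \<noteq> 0 \<longrightarrow> h (Suc L) i = h (Suc L) j"
    "(\<Sum>i\<in>J. \<Sum>j\<in>J. \<gamma>' i j)
      = (\<Sum>A\<in>h (Suc L) ` J. min (\<Sum>i | i \<in> J \<and> h (Suc L) i = A. \<mu> i)
                               (\<Sum>j | j \<in> J \<and> h (Suc L) j = A. \<nu> j))"
    by blast
  have "\<forall>m\<le>Suc L. (\<Sum>A\<in>h m ` J. min (\<Sum>i | i \<in> J \<and> h m i = A. \<mu> i) (\<Sum>j | j \<in> J \<and> h m j = A. \<nu> j))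
        \<le> (\<Sum>i\<in>J. \<Sum>j\<in>J. if h m i = h m j then \<gamma>' i j else 0)"
  proof (intro allI impI, goal_cases)
    case (1 m)
    show ?case
    proof (cases "m = Suc L")
      case True
      have "(\<Sum>i\<in>J. \<Sum>j\<in>J. if h m i = h m j then \<gamma>' i j else 0) = (\<Sum>i\<in>J. \<Sum>j\<in>J. \<gamma>' i j)"
        using \<gamma>'(5) True by (intro sum.cong refl) auto
      then show ?thesis using \<gamma>'(6) True by simp
    next
      case False
      then have "m \<le> L" using 1 by simp
      then show ?thesis
        by (rule order_trans[OF \<gamma>(5)]) (use \<gamma>'(1) in \<open>intro sum_mono, auto\<close>)
    qed
  qed
  with \<gamma>'(2-6) show ?case
    by (intro exI[of _ \<gamma>']) (intro conjI; assumption)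
qed

section \<open>Coupling two laws at all scales\<close>

lemma finite_pmf_of_weights:
  fixes f :: "'b \<Rightarrow> real"
  assumes "finite J" "\<And>x. 0 \<le> f x" "\<And>x. x \<notin> J \<Longrightarrow> f x = 0" "sum f J = 1"
  shows "\<exists>p. pmf p = f"
proof -
  have "(\<integral>\<^sup>+ x. ennreal (f x) \<partial>count_space UNIV) = (\<Sum>x\<in>J. ennreal (f x))"
    using assms by (intro nn_integral_count_space') auto
  also have "\<dots> = 1" using assms by (simp add: sum_ennreal)
  finally show ?thesis
    using assms(2) by (intro exI[of _ "embed_pmf f"] ext pmf_embed_pmf) auto
qed

text \<open>
  As \<open>h L\<close> has a single cell, the matching ends with all the mass matched and is a coupling. The
  probability that the two components lie in different cells of \<open>h m\<close> is then at most the total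
  variation distance of the two laws on these cells.
\<close>

lemma hierarchical_coupling:
  fixes \<mu> \<nu> :: "'b pmf" and h :: "nat \<Rightarrow> 'b \<Rightarrow> 'c"
  assumes "finite J" "set_pmf \<mu> \<subseteq> J" "set_pmf \<nu> \<subseteq> J"
    and coarser: "\<forall>m i j. h m i = h m j \<longrightarrow> h (Suc m) i = h (Suc m) j"
    and top: "\<And>i j. i \<in> J \<Longrightarrow> j \<in> J \<Longrightarrow> h L i = h L j"
  shows "\<exists>\<gamma>. map_pmf fst \<gamma> = \<mu> \<and> map_pmf snd \<gamma> = \<nu> \<and>
    (\<forall>m\<le>L. measure_pmf.prob \<gamma> {(i, j). h m i \<noteq> h m j}
       \<le> (\<Sum>A\<in>h m ` J. \<bar>measure_pmf.prob \<mu> {i. h m i = A} - measure_pmf.prob \<nu> {i. h m i = A}\<bar>) / 2)"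
proof -
  have tot: "sum (pmf \<mu>) J = 1" "sum (pmf \<nu>) J = 1"
    using assms by (auto intro!: sum_pmf_eq_1)
  have cellprob: "measure_pmf.prob \<rho> {i. h m i = A} = (\<Sum>i | i \<in> J \<and> h m i = A. pmf \<rho> i)"
    if "set_pmf \<rho> \<subseteq> J" for \<rho> m A
  proof -
    have "measure_pmf.prob \<rho> {i. h m i = A} = measure_pmf.prob \<rho> {i \<in> J. h m i = A}"
      using that by (intro measure_pmf.finite_measure_eq_AE) (auto simp: AE_measure_pmf_iff)
    then show ?thesis using assms(1) by (simp add: measure_measure_pmf_finite)
  qed
  from hierarchical_matching[of J "pmf \<mu>" "pmf \<nu>" h L, OF assms(1) pmf_nonneg pmf_nonneg coarser]
  obtain g where g: "\<forall>i j. 0 \<le> g i j" "\<forall>i\<in>J. (\<Sum>j\<in>J. g i j) \<le> pmf \<mu> i"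
    "\<forall>j\<in>J. (\<Sum>i\<in>J. g i j) \<le> pmf \<nu> j"
    "\<forall>m\<le>L. (\<Sum>A\<in>h m ` J. min (\<Sum>i | i \<in> J \<and> h m i = A. pmf \<mu> i) (\<Sum>j | j \<in> J \<and> h m j = A. pmf \<nu> j))
        \<le> (\<Sum>i\<in>J. \<Sum>j\<in>J. if h m i = h m j then g i j else 0)"
    "(\<Sum>i\<in>J. \<Sum>j\<in>J. g i j)
      = (\<Sum>A\<in>h L ` J. min (\<Sum>i | i \<in> J \<and> h L i = A. pmf \<mu> i) (\<Sum>j | j \<in> J \<and> h L j = A. pmf \<nu> j))"
    by (elim exE conjE) (rule that; assumption)
  have "J \<noteq> {}" using tot by auto
  then obtain j0 where j0: "j0 \<in> J" by auto
  have "h L ` J = {h L j0}" using top j0 by blast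
  moreover have "{i. i \<in> J \<and> h L i = h L j0} = J" using top j0 by blast
  ultimately have mass: "(\<Sum>i\<in>J. \<Sum>j\<in>J. g i j) = 1" using g(5) tot by simp
  have row: "(\<Sum>j\<in>J. g i j) = pmf \<mu> i" if "i \<in> J" for i
  proof (rule sum_mono_inv[where I = J])
    show "(\<Sum>i\<in>J. \<Sum>j\<in>J. g i j) = sum (pmf \<mu>) J" by (simp only: mass tot)
  qed (use g(2) that assms(1) in blast)+
  have col: "(\<Sum>i\<in>J. g i j) = pmf \<nu> j" if "j \<in> J" for j
  proof (rule sum_mono_inv[where I = J])
    have "(\<Sum>j\<in>J. \<Sum>i\<in>J. g i j) = 1" by (subst sum.swap) (rule mass)
    then show "(\<Sum>j\<in>J. \<Sum>i\<in>J. g i j) = sum (pmf \<nu>) J" by (simp only: tot)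
  qed (use g(3) that assms(1) in blast)+
  define f where "f = (\<lambda>(i, j). if i \<in> J \<and> j \<in> J then g i j else 0)"
  have "\<exists>p. pmf p = f"
    using assms(1) g(1) mass
    by (intro finite_pmf_of_weights[of "J \<times> J"]) (auto simp: f_def sum.cartesian_product[symmetric] split: if_splits)
  then obtain \<gamma> where \<gamma>: "pmf \<gamma> = f" by auto
  have supp: "set_pmf \<gamma> \<subseteq> J \<times> J"
    by (auto simp: set_pmf_eq \<gamma> f_def split: if_splits)
  have prob: "measure_pmf.prob \<gamma> {(i, j). P i j} = (\<Sum>i\<in>J. \<Sum>j\<in>J. if P i j then g i j else 0)" for P
  proof -
    have "measure_pmf.prob \<gamma> {(i, j). P i j} = measure_pmf.prob \<gamma> {x \<in> J \<times> J. case x of (i, j) \<Rightarrow> P i j}"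
      using supp by (intro measure_pmf.finite_measure_eq_AE) (auto simp: AE_measure_pmf_iff)
    also have "\<dots> = (\<Sum>x | x \<in> J \<times> J \<and> (case x of (i, j) \<Rightarrow> P i j). f x)"
      using assms(1) by (simp add: measure_measure_pmf_finite \<gamma>)
    also have "\<dots> = (\<Sum>x\<in>J \<times> J. if (case x of (i, j) \<Rightarrow> P i j) then f x else 0)"
      using assms(1) by (intro sum.inter_filter) auto
    also have "\<dots> = (\<Sum>i\<in>J. \<Sum>j\<in>J. if P i j then g i j else 0)"
      unfolding sum.cartesian_product by (intro sum.cong) (auto simp: f_def)
    finally show ?thesis .
  qed
  have "map_pmf fst \<gamma> = \<mu>"
  proof (rule pmf_eqI)
    fix i
    have "pmf (map_pmf fst \<gamma>) i = measure_pmf.prob \<gamma> {(i', j). i' = i}"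
      unfolding pmf_map by (rule arg_cong[where f="measure_pmf.prob \<gamma>"]) auto
    also have "\<dots> = (\<Sum>a\<in>J. if a = i then (\<Sum>b\<in>J. g a b) else 0)"
      unfolding prob by (intro sum.cong refl) simp
    also have "\<dots> = (if i \<in> J then (\<Sum>b\<in>J. g i b) else 0)"
      using assms(1) by (rule sum.delta)
    also have "\<dots> = (if i \<in> J then pmf \<mu> i else 0)" using row by simp
    also have "\<dots> = pmf \<mu> i" using assms(2) by (auto simp: set_pmf_eq)
    finally show "pmf (map_pmf fst \<gamma>) i = pmf \<mu> i" .
  qed
  moreover have "map_pmf snd \<gamma> = \<nu>"
  proof (rule pmf_eqI)
    fix j
    have "pmf (map_pmf snd \<gamma>) j = measure_pmf.prob \<gamma> {(i, j'). j' = j}"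
      unfolding pmf_map by (rule arg_cong[where f="measure_pmf.prob \<gamma>"]) auto
    also have "\<dots> = (\<Sum>a\<in>J. if j \<in> J then g a j else 0)"
      unfolding prob by (intro sum.cong refl sum.delta assms(1))
    also have "\<dots> = (if j \<in> J then pmf \<nu> j else 0)" using col by simp
    also have "\<dots> = pmf \<nu> j" using assms(3) by (auto simp: set_pmf_eq)
    finally show "pmf (map_pmf snd \<gamma>) j = pmf \<nu> j" .
  qed
  moreover have "measure_pmf.prob \<gamma> {(i, j). h m i \<noteq> h m j}
       \<le> (\<Sum>A\<in>h m ` J. \<bar>measure_pmf.prob \<mu> {i. h m i = A} - measure_pmf.prob \<nu> {i. h m i = A}\<bar>) / 2"
    if "m \<le> L" for m
  proof -
    let ?m = "\<lambda>A. measure_pmf.prob \<mu> {i. h m i = A}" and ?n = "\<lambda>A. measure_pmf.prob \<nu> {i. h m i = A}"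
    have "(\<Sum>A\<in>h m ` J. ?m A) = 1"
      unfolding cellprob[OF assms(2)] sum.image_gen[OF assms(1), symmetric] by (rule tot)
    moreover have "(\<Sum>A\<in>h m ` J. ?n A) = 1"
      unfolding cellprob[OF assms(3)] sum.image_gen[OF assms(1), symmetric] by (rule tot)
    moreover have "(\<Sum>A\<in>h m ` J. min (?m A) (?n A))
        \<le> measure_pmf.prob \<gamma> {(i, j). h m i = h m j}"
      unfolding prob cellprob[OF assms(2)] cellprob[OF assms(3)] using g(4) that by blast
    moreover have "measure_pmf.prob \<gamma> {(i, j). h m i \<noteq> h m j}
        = 1 - measure_pmf.prob \<gamma> {(i, j). h m i = h m j}"
    proof -
      have "{(i, j). h m i \<noteq> h m j} = UNIV - {(i, j). h m i = h m j}" by auto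
      then show ?thesis using measure_pmf.prob_compl[of "{(i, j). h m i = h m j}" \<gamma>] by simp
    qed
    moreover have "(\<Sum>A\<in>h m ` J. \<bar>?m A - ?n A\<bar>)
        = (\<Sum>A\<in>h m ` J. ?m A) + (\<Sum>A\<in>h m ` J. ?n A) - 2 * (\<Sum>A\<in>h m ` J. min (?m A) (?n A))"
      unfolding sum_distrib_left sum.distrib[symmetric] sum_subtractf[symmetric]
      by (intro sum.cong refl) (auto simp: min_def)
    ultimately show ?thesis by simp
  qed
  ultimately show ?thesis by blast
qed

section \<open>Coupling a random list with independent entries\<close>

lemma prob_bind_pmf_finite:
  assumes "finite C" "set_pmf p \<subseteq> C"
  shows "measure_pmf.prob (bind_pmf p f) X = (\<Sum>c\<in>C. pmf p c * measure_pmf.prob (f c) X)"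
proof -
  have "ennreal (measure_pmf.prob (bind_pmf p f) X) = (\<integral>\<^sup>+c. ennreal (measure_pmf.prob (f c) X) \<partial>p)"
    by (simp add: measure_pmf.emeasure_eq_measure[symmetric])
  also have "\<dots> = (\<Sum>c\<in>C. ennreal (measure_pmf.prob (f c) X) * pmf p c)"
    using assms by (intro nn_integral_measure_pmf_support) auto
  also have "\<dots> = ennreal (\<Sum>c\<in>C. pmf p c * measure_pmf.prob (f c) X)"
    by (subst sum_ennreal[symmetric]) (simp_all add: ennreal_mult mult.commute)
  finally show ?thesis by (simp add: sum_nonneg)
qed

text \<open>
  For every value \<open>c\<close> of the second component, the conditional law of the first one is coupled
  with its unconditional law. As the second marginal of \<open>\<gamma> c\<close> does not depend on \<open>c\<close>, the copy is
  independent of the condition. On average over \<open>c\<close> the total variation distances add up to half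
  the absolute sum of the matrix \<open>v\<close> below, whose rectangle sums are bounded by \<open>\<alpha>\<close>.
\<close>

lemma coupling_independent_of_condition:
  fixes p :: "('b \<times> 'c) pmf" and h :: "nat \<Rightarrow> 'b \<Rightarrow> 'd"
  assumes "finite J" "finite C" "set_pmf p \<subseteq> J \<times> C"
    and coarser: "\<forall>m i j. h m i = h m j \<longrightarrow> h (Suc m) i = h (Suc m) j"
    and top: "\<And>i j. i \<in> J \<Longrightarrow> j \<in> J \<Longrightarrow> h L i = h L j"
    and alpha: "\<And>S T. \<bar>measure_pmf.prob p (S \<times> T)
      - measure_pmf.prob (map_pmf fst p) S * measure_pmf.prob (map_pmf snd p) T\<bar> \<le> \<alpha>"
  shows "\<exists>\<gamma>. bind_pmf (map_pmf snd p) (\<lambda>c. map_pmf (\<lambda>i. (i, c)) (map_pmf fst (\<gamma> c))) = p \<and>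
    (\<forall>c. map_pmf snd (\<gamma> c) = map_pmf fst p) \<and>
    (\<forall>m\<le>L. measure_pmf.prob (bind_pmf (map_pmf snd p) \<gamma>) {(i, j). h m i \<noteq> h m j}
       \<le> 2 * sqrt 3 * sqrt (card (h m ` J)) * \<alpha>)"
proof -
  define \<nu> where "\<nu> = map_pmf fst p"
  define pc where "pc = map_pmf snd p"
  define \<kappa> where "\<kappa> c = cond_pmf p {x. c = snd x}" for c
  \<comment> \<open>Off the support the conditional law is undefined; \<open>\<nu>\<close> keeps \<open>\<gamma> c\<close> a coupling with second marginal \<open>\<nu>\<close>.\<close>
  define \<mu> where "\<mu> c = (if c \<in> set_pmf pc then map_pmf fst (\<kappa> c) else \<nu>)" for c
  have ne: "set_pmf p \<inter> {x. c = snd x} \<noteq> {}" if "c \<in> set_pmf pc" for c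
    using that by (auto simp: pc_def)
  have pcC: "set_pmf pc \<subseteq> C" using assms(3) by (auto simp: pc_def)
  have \<nu>J: "set_pmf \<nu> \<subseteq> J" using assms(3) by (auto simp: \<nu>_def)
  have \<mu>J: "set_pmf (\<mu> c) \<subseteq> J" for c
    using \<nu>J assms(3) ne by (auto simp: \<mu>_def \<kappa>_def)
  have pc_prob: "pmf pc c = measure_pmf.prob p {x. c = snd x}" for c
    unfolding pc_def pmf_map by (rule arg_cong[where f="measure_pmf.prob p"]) auto
  have disint: "bind_pmf pc (\<lambda>c. map_pmf (\<lambda>i. (i, c)) (\<mu> c)) = p"
  proof -
    have "map_pmf (\<lambda>i. (i, c)) (\<mu> c) = \<kappa> c" if "c \<in> set_pmf pc" for c
    proof -
      have "map_pmf (\<lambda>x. (fst x, c)) (\<kappa> c) = map_pmf id (\<kappa> c)"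
        using ne[OF that] by (intro map_pmf_cong) (auto simp: \<kappa>_def)
      then show ?thesis using that by (simp add: \<mu>_def map_pmf_comp)
    qed
    then have "bind_pmf pc (\<lambda>c. map_pmf (\<lambda>i. (i, c)) (\<mu> c)) = bind_pmf pc \<kappa>"
      by (intro bind_pmf_cong) auto
    also have "\<dots> = p"
      unfolding \<kappa>_def
    proof (rule bind_cond_pmf_cancel)
      fix c y assume "c \<in> set_pmf pc" "y \<in> set_pmf p" "c = snd y"
      then have "{x. x = snd y} = {c}" by auto
      then show "measure_pmf.prob p {y. c = snd y} = measure_pmf.prob pc {x. x = snd y}"
        by (simp add: pc_prob[symmetric] measure_pmf_single)
    qed (use ne in \<open>auto simp: pc_def\<close>)
    finally show ?thesis .
  qed
  have joint: "pmf pc c * measure_pmf.prob (\<mu> c) S = measure_pmf.prob p (S \<times> {c})" for c S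
  proof -
    have "measure_pmf.prob p (S \<times> {c})
        = measure_pmf.prob (bind_pmf pc (\<lambda>c. map_pmf (\<lambda>i. (i, c)) (\<mu> c))) (S \<times> {c})"
      by (simp only: disint)
    also have "\<dots> = (\<Sum>c'\<in>insert c C. pmf pc c' * (if c' = c then measure_pmf.prob (\<mu> c) S else 0))"
      using assms(2) pcC
      by (subst prob_bind_pmf_finite[of "insert c C"])
         (auto intro!: sum.cong arg_cong2[where f="(*)"] simp: measure_map_pmf vimage_def)
    also have "\<dots> = pmf pc c * measure_pmf.prob (\<mu> c) S"
      using assms(2) by (simp add: if_distrib sum.delta cong: if_cong)
    finally show ?thesis ..
  qed
  have "\<forall>c. \<exists>\<gamma>. map_pmf fst \<gamma> = \<mu> c \<and> map_pmf snd \<gamma> = \<nu> \<and>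
    (\<forall>m\<le>L. measure_pmf.prob \<gamma> {(i, j). h m i \<noteq> h m j} \<le> (\<Sum>A\<in>h m ` J.
       \<bar>measure_pmf.prob (\<mu> c) {i. h m i = A} - measure_pmf.prob \<nu> {i. h m i = A}\<bar>) / 2)"
    by (intro allI hierarchical_coupling[OF assms(1) \<mu>J \<nu>J coarser top])
  from choice[OF this] obtain \<gamma> where \<gamma>_all: "\<forall>c. map_pmf fst (\<gamma> c) = \<mu> c \<and> map_pmf snd (\<gamma> c) = \<nu> \<and>
    (\<forall>m\<le>L. measure_pmf.prob (\<gamma> c) {(i, j). h m i \<noteq> h m j} \<le> (\<Sum>A\<in>h m ` J.
       \<bar>measure_pmf.prob (\<mu> c) {i. h m i = A} - measure_pmf.prob \<nu> {i. h m i = A}\<bar>) / 2)"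
    by (elim exE) (rule that; assumption)
  then have \<gamma>: "\<And>c. map_pmf fst (\<gamma> c) = \<mu> c" "\<And>c. map_pmf snd (\<gamma> c) = \<nu>"
    "\<And>c m. m \<le> L \<Longrightarrow> measure_pmf.prob (\<gamma> c) {(i, j). h m i \<noteq> h m j} \<le> (\<Sum>A\<in>h m ` J.
       \<bar>measure_pmf.prob (\<mu> c) {i. h m i = A} - measure_pmf.prob \<nu> {i. h m i = A}\<bar>) / 2"
    by simp_all
  have "measure_pmf.prob (bind_pmf pc \<gamma>) {(i, j). h m i \<noteq> h m j}
       \<le> 2 * sqrt 3 * sqrt (card (h m ` J)) * \<alpha>" if "m \<le> L" for m
  proof -
    define q where "q = map_pmf (\<lambda>(i, c). (h m i, c)) p"
    define v where "v A c = pmf q (A, c) - pmf (map_pmf fst q) A * pmf pc c" for A c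
    have v: "v A c = pmf pc c * (measure_pmf.prob (\<mu> c) {i. h m i = A} - measure_pmf.prob \<nu> {i. h m i = A})" for A c
    proof -
      have "pmf q (A, c) = measure_pmf.prob p ({i. h m i = A} \<times> {c})"
        unfolding q_def pmf_map by (rule arg_cong[where f="measure_pmf.prob p"]) auto
      moreover have "pmf (map_pmf fst q) A = measure_pmf.prob \<nu> {i. h m i = A}"
        by (auto simp: q_def \<nu>_def pmf_map map_pmf_comp case_prod_unfold vimage_def)
      ultimately show ?thesis by (simp add: v_def joint[symmetric] algebra_simps)
    qed
    have rect: "\<bar>\<Sum>A\<in>S. \<Sum>c\<in>T. v A c\<bar> \<le> \<alpha>" if "S \<subseteq> h m ` J" "T \<subseteq> C" for S T
    proof -
      have fin: "finite S" "finite T" using that assms(1,2) by (auto intro: finite_subset)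
      have "(\<Sum>A\<in>S. \<Sum>c\<in>T. v A c) = (\<Sum>x\<in>S \<times> T. pmf q x)
          - (\<Sum>A\<in>S. pmf (map_pmf fst q) A) * (\<Sum>c\<in>T. pmf pc c)"
        unfolding v_def by (simp add: sum_subtractf sum.cartesian_product sum_product)
      also have "\<dots> = measure_pmf.prob q (S \<times> T)
          - measure_pmf.prob (map_pmf fst q) S * measure_pmf.prob pc T"
        using fin by (simp only: measure_measure_pmf_finite finite_cartesian_product)
      also have "measure_pmf.prob q (S \<times> T) = measure_pmf.prob p ((h m -` S) \<times> T)"
        unfolding q_def measure_map_pmf by (rule arg_cong[where f="measure_pmf.prob p"]) auto
      also have "measure_pmf.prob (map_pmf fst q) S = measure_pmf.prob (map_pmf fst p) (h m -` S)"
        by (auto simp: q_def map_pmf_comp case_prod_unfold vimage_def)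
      finally show ?thesis using alpha[of "h m -` S" T] by (simp add: pc_def)
    qed
    have "measure_pmf.prob (bind_pmf pc \<gamma>) {(i, j). h m i \<noteq> h m j}
        = (\<Sum>c\<in>C. pmf pc c * measure_pmf.prob (\<gamma> c) {(i, j). h m i \<noteq> h m j})"
      by (rule prob_bind_pmf_finite[OF assms(2) pcC])
    also have "\<dots> \<le> (\<Sum>c\<in>C. pmf pc c * ((\<Sum>A\<in>h m ` J.
       \<bar>measure_pmf.prob (\<mu> c) {i. h m i = A} - measure_pmf.prob \<nu> {i. h m i = A}\<bar>) / 2))"
      by (intro sum_mono mult_left_mono \<gamma>(3)[OF that] pmf_nonneg)
    also have "\<dots> = (\<Sum>c\<in>C. \<Sum>A\<in>h m ` J. \<bar>v A c\<bar>) / 2"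
      unfolding v by (simp add: abs_mult sum_distrib_left sum_divide_distrib)
    also have "\<dots> \<le> (4 * sqrt 3 * sqrt (card (h m ` J)) * \<alpha>) / 2"
      using assms(1,2) rect by (intro divide_right_mono sum_abs_le_of_rectangles) auto
    finally show ?thesis by (simp add: algebra_simps)
  qed
  then show ?thesis
    using \<gamma>(1,2) disint unfolding pc_def \<nu>_def by (intro exI[of _ \<gamma>]) auto
qed

text \<open>
  The tail of the list is coupled first. Given the tail, the head is coupled with a copy that is
  independent of the tail, and therefore also of the copy of the tail, which is drawn from the tail
  with independent randomness. This is why every entry needs to be compared with the later ones only.
\<close>

lemma coupling_with_independent_list:
  fixes p :: "'b list pmf" and h :: "nat \<Rightarrow> 'b \<Rightarrow> 'd"
  assumes "finite J"
    and coarser: "\<forall>m i j. h m i = h m j \<longrightarrow> h (Suc m) i = h (Suc m) j"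
    and top: "\<And>i j. i \<in> J \<Longrightarrow> j \<in> J \<Longrightarrow> h L i = h L j"
    and "set_pmf p \<subseteq> {z. set z \<subseteq> J \<and> length z = k}"
    and "\<And>i S T. i < k \<Longrightarrow> \<bar>measure_pmf.prob p {z. z ! i \<in> S \<and> drop (Suc i) z \<in> T}
      - measure_pmf.prob p {z. z ! i \<in> S} * measure_pmf.prob p {z. drop (Suc i) z \<in> T}\<bar> \<le> \<alpha> i"
  shows "\<exists>G. map_pmf fst G = p \<and>
    (\<forall>z. pmf (map_pmf snd G) z
       = (if length z = k then \<Prod>i<k. pmf (map_pmf (\<lambda>z. z ! i) p) (z ! i) else 0)) \<and>
    (\<forall>i<k. \<forall>m\<le>L. measure_pmf.prob G {(z, z'). h m (z ! i) \<noteq> h m (z' ! i)}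
       \<le> 2 * sqrt 3 * sqrt (card (h m ` J)) * \<alpha> i)"
  using assms(4,5)
proof (induction k arbitrary: p \<alpha>)
  case 0
  then have "p = return_pmf []" by (auto simp: set_pmf_subset_singleton[symmetric])
  then show ?case by (intro exI[of _ "return_pmf ([], [])"]) (auto simp: indicator_def)
next
  case (Suc k)
  define p' where "p' = map_pmf tl p"
  define q where "q = map_pmf (\<lambda>z. (hd z, tl z)) p"
  define \<nu> where "\<nu> = map_pmf hd p"
  have cons: "\<exists>j c. z = j # c \<and> j \<in> J \<and> set c \<subseteq> J \<and> length c = k" if "z \<in> set_pmf p" for z
    using subsetD[OF Suc.prems(1) that] by (cases z) auto
  have on_support: "measure_pmf.prob p {z. P z} = measure_pmf.prob p {z. Q z}"
    if "\<And>j c. length c = k \<Longrightarrow> P (j # c) = Q (j # c)" for P Q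
    using that cons by (intro measure_pmf.finite_measure_eq_AE) (fastforce simp: AE_measure_pmf_iff)+
  have p'_sub: "set_pmf p' \<subseteq> {z. set z \<subseteq> J \<and> length z = k}"
    using cons by (fastforce simp: p'_def)
  have "\<bar>measure_pmf.prob p' {z. z ! i \<in> S \<and> drop (Suc i) z \<in> T}
      - measure_pmf.prob p' {z. z ! i \<in> S} * measure_pmf.prob p' {z. drop (Suc i) z \<in> T}\<bar> \<le> \<alpha> (Suc i)"
    if "i < k" for i S T
  proof -
    have "measure_pmf.prob p' {z. z ! i \<in> S \<and> drop (Suc i) z \<in> T}
        = measure_pmf.prob p {z. z ! Suc i \<in> S \<and> drop (Suc (Suc i)) z \<in> T}"
      "measure_pmf.prob p' {z. z ! i \<in> S} = measure_pmf.prob p {z. z ! Suc i \<in> S}"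
      "measure_pmf.prob p' {z. drop (Suc i) z \<in> T} = measure_pmf.prob p {z. drop (Suc (Suc i)) z \<in> T}"
      unfolding p'_def measure_map_pmf vimage_def mem_Collect_eq by (rule on_support; simp)+
    then show ?thesis using Suc.prems(2)[of "Suc i" S T] that by simp
  qed
  from Suc.IH[OF p'_sub this]
  obtain G where G: "map_pmf fst G = p'"
    "\<And>z. pmf (map_pmf snd G) z
       = (if length z = k then \<Prod>i<k. pmf (map_pmf (\<lambda>z. z ! i) p') (z ! i) else 0)"
    "\<And>i m. i < k \<Longrightarrow> m \<le> L \<Longrightarrow> measure_pmf.prob G {(z, z'). h m (z ! i) \<noteq> h m (z' ! i)}
       \<le> 2 * sqrt 3 * sqrt (card (h m ` J)) * \<alpha> (Suc i)"
    by blast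
  have q_marg: "map_pmf fst q = \<nu>" "map_pmf snd q = p'"
    by (simp_all add: q_def \<nu>_def p'_def map_pmf_comp)
  have fin: "finite {z. set z \<subseteq> J \<and> length z = k}"
    using assms(1) by (rule finite_lists_length_eq)
  have q_sub: "set_pmf q \<subseteq> J \<times> {z. set z \<subseteq> J \<and> length z = k}"
    using cons by (fastforce simp: q_def)
  have q_alpha: "\<bar>measure_pmf.prob q (S \<times> T)
      - measure_pmf.prob (map_pmf fst q) S * measure_pmf.prob (map_pmf snd q) T\<bar> \<le> \<alpha> 0" for S T
  proof -
    have "measure_pmf.prob q (S \<times> T) = measure_pmf.prob p {z. z ! 0 \<in> S \<and> drop (Suc 0) z \<in> T}"
      "measure_pmf.prob \<nu> S = measure_pmf.prob p {z. z ! 0 \<in> S}"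
      "measure_pmf.prob p' T = measure_pmf.prob p {z. drop (Suc 0) z \<in> T}"
      unfolding q_def \<nu>_def p'_def measure_map_pmf vimage_def by (rule on_support; simp)+
    then show ?thesis using Suc.prems(2)[of 0 S T] by (simp add: q_marg)
  qed
  from coupling_independent_of_condition[OF assms(1) fin q_sub coarser top q_alpha]
  obtain \<gamma> where \<gamma>: "bind_pmf p' (\<lambda>c. map_pmf (\<lambda>i. (i, c)) (map_pmf fst (\<gamma> c))) = q"
    "\<And>c. map_pmf snd (\<gamma> c) = \<nu>"
    "\<And>m. m \<le> L \<Longrightarrow> measure_pmf.prob (bind_pmf p' \<gamma>) {(i, j). h m i \<noteq> h m j}
       \<le> 2 * sqrt 3 * sqrt (card (h m ` J)) * \<alpha> 0"
    unfolding q_marg by blast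
  define G' where "G' = bind_pmf G (\<lambda>(c, c'). map_pmf (\<lambda>(j, j'). (j # c, j' # c')) (\<gamma> c))"
  have "map_pmf fst G' = bind_pmf (map_pmf fst G) (\<lambda>c. map_pmf (\<lambda>(j, j'). j # c) (\<gamma> c))"
    by (simp add: G'_def map_bind_pmf bind_map_pmf map_pmf_comp case_prod_unfold)
  also have "\<dots> = map_pmf (\<lambda>(j, c). j # c) q"
    unfolding G(1) \<gamma>(1)[symmetric] by (simp add: map_bind_pmf map_pmf_comp case_prod_unfold)
  also have "\<dots> = map_pmf id p"
    unfolding q_def map_pmf_comp using cons by (intro map_pmf_cong) fastforce+
  finally have G'_fst: "map_pmf fst G' = p" by simp
  have G'_snd: "map_pmf snd G' = map_pmf (\<lambda>(c, j). j # c) (pair_pmf (map_pmf snd G) \<nu>)"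
  proof -
    have "map_pmf snd G' = bind_pmf G (\<lambda>(c, c'). map_pmf (\<lambda>j. j # c') (map_pmf snd (\<gamma> c)))"
      by (simp add: G'_def map_bind_pmf map_pmf_comp case_prod_unfold)
    also have "\<dots> = bind_pmf (map_pmf snd G) (\<lambda>c'. map_pmf (\<lambda>j. j # c') \<nu>)"
      by (simp add: \<gamma>(2) bind_map_pmf case_prod_unfold)
    also have "\<dots> = map_pmf (\<lambda>(c, j). j # c) (pair_pmf (map_pmf snd G) \<nu>)"
      by (simp add: pair_pmf_def map_bind_pmf map_pmf_def bind_assoc_pmf bind_return_pmf)
    finally show ?thesis .
  qed
  have marg: "pmf (map_pmf snd G') z
       = (if length z = Suc k then \<Prod>i<Suc k. pmf (map_pmf (\<lambda>z. z ! i) p) (z ! i) else 0)" for z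
  proof (cases z)
    case Nil
    then have "z \<notin> set_pmf (map_pmf snd G')" unfolding G'_snd by auto
    then have "pmf (map_pmf snd G') z = 0" by (simp only: pmf_eq_0_set_pmf not_False_eq_True)
    then show ?thesis using Nil by simp
  next
    case (Cons j c)
    have "inj (\<lambda>(c, j). j # c)" by (auto simp: inj_on_def)
    from pmf_map_inj'[OF this, of _ "(c, j)"]
    have "pmf (map_pmf snd G') z = pmf (map_pmf snd G) c * pmf \<nu> j"
      unfolding G'_snd Cons by (simp add: pmf_pair)
    moreover have "map_pmf (\<lambda>z. z ! 0) p = \<nu>"
      unfolding \<nu>_def using cons by (intro map_pmf_cong) fastforce+
    moreover have "map_pmf (\<lambda>z. z ! Suc i) p = map_pmf (\<lambda>z. z ! i) p'" for i
      unfolding p'_def map_pmf_comp using cons by (intro map_pmf_cong) fastforce+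
    ultimately show ?thesis
      unfolding Cons prod.lessThan_Suc_shift by (simp add: G(2) mult.commute)
  qed
  have mism: "measure_pmf.prob G' {(z, z'). h m (z ! i) \<noteq> h m (z' ! i)}
       \<le> 2 * sqrt 3 * sqrt (card (h m ` J)) * \<alpha> i" if "i < Suc k" "m \<le> L" for i m
  proof -
    have proj: "measure_pmf.prob R {(z, z'). h m (z ! n) \<noteq> h m (z' ! n)}
      = measure_pmf.prob (map_pmf (\<lambda>(z, z'). (z ! n, z' ! n)) R) {(i, j). h m i \<noteq> h m j}"
      for R :: "('b list \<times> 'b list) pmf" and n
      unfolding measure_map_pmf by (rule arg_cong[where f="measure_pmf.prob R"]) auto
    show ?thesis
    proof (cases i)
      case 0
      have "map_pmf (\<lambda>(z, z'). (z ! 0, z' ! 0)) G' = bind_pmf (map_pmf fst G) \<gamma>"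
        by (simp add: G'_def map_bind_pmf bind_map_pmf map_pmf_comp case_prod_unfold)
      then show ?thesis using \<gamma>(3)[OF that(2)] 0 by (simp add: proj G(1))
    next
      case (Suc n)
      have "map_pmf (\<lambda>(z, z'). (z ! Suc n, z' ! Suc n)) G' = map_pmf (\<lambda>(z, z'). (z ! n, z' ! n)) G"
        by (simp add: G'_def map_bind_pmf map_pmf_comp case_prod_unfold map_pmf_const)
           (simp add: map_pmf_def case_prod_unfold)
      then show ?thesis using G(3)[of n m] that Suc by (simp add: proj)
    qed
  qed
  show ?case
  proof (intro exI[of _ G'] conjI allI impI)
    show "map_pmf fst G' = p" by (rule G'_fst)
  qed (rule marg, rule mism)
qed

section \<open>Lifting a discrete coupling\<close>

lemma measurable_count_space_Pair:
  fixes f :: "'a \<Rightarrow> 'c::countable" and g :: "'a \<Rightarrow> 'd::countable"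
  assumes "f \<in> measurable M (count_space UNIV)" "g \<in> measurable M (count_space UNIV)"
  shows "(\<lambda>x. (f x, g x)) \<in> measurable M (count_space UNIV)"
  using measurable_Pair[OF assms] by (simp add: pair_measure_countable)

lemma measurable_count_space_map_list:
  fixes f :: "'i \<Rightarrow> 'a \<Rightarrow> 'c::countable"
  assumes "\<And>i. i \<in> set is \<Longrightarrow> f i \<in> measurable M (count_space UNIV)"
  shows "(\<lambda>x. map (\<lambda>i. f i x) is) \<in> measurable M (count_space UNIV)"
  using assms
proof (induction "is")
  case Nil
  then show ?case by simp
next
  case (Cons i "is")
  have "(\<lambda>x. (f i x, map (\<lambda>i. f i x) is)) \<in> measurable M (count_space UNIV)"
    using Cons by (intro measurable_count_space_Pair) auto
  from measurable_compose[OF this, of "\<lambda>(a, b). a # b" "count_space UNIV"]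
  show ?case by simp
qed

text \<open>
  The values of probability zero form a countable set, which is therefore null.
\<close>

lemma law_as_pmf:
  fixes Z :: "'a \<Rightarrow> 'c::countable"
  assumes "prob_space M" "Z \<in> measurable M (count_space UNIV)"
  shows "\<exists>p. measure_pmf p = distr M (count_space UNIV) Z"
proof -
  let ?D = "distr M (count_space UNIV) Z"
  interpret M: prob_space M by fact
  interpret D: prob_space ?D by (rule M.prob_space_distr) fact
  let ?N = "{c. measure ?D {c} = 0}"
  have "emeasure ?D ?N = (\<integral>\<^sup>+c. emeasure ?D {c} \<partial>count_space ?N)"
    by (rule emeasure_countable_singleton) auto
  also have "\<dots> = (\<integral>\<^sup>+c. 0 \<partial>count_space ?N)"
    by (intro nn_integral_cong) (simp add: D.emeasure_eq_measure)
  finally have "emeasure ?D ?N = 0" by simp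
  then have "AE c in ?D. measure ?D {c} \<noteq> 0"
    by (intro AE_I[of _ _ ?N]) auto
  then have "measure_pmf (Abs_pmf ?D) = ?D"
    using D.prob_space_axioms by (intro Abs_pmf_inverse) auto
  then show ?thesis by blast
qed

lemma pmf_marginal_pos:
  assumes "pmf G (c, d) \<noteq> 0"
  shows "pmf (map_pmf fst G) c \<noteq> 0" "pmf (map_pmf snd G) d \<noteq> 0"
proof -
  have "(c, d) \<in> set_pmf G" using assms by (simp add: set_pmf_iff)
  then have "c \<in> set_pmf (map_pmf fst G)" "d \<in> set_pmf (map_pmf snd G)" by force+
  then show "pmf (map_pmf fst G) c \<noteq> 0" "pmf (map_pmf snd G) d \<noteq> 0"
    by (simp_all only: pmf_eq_0_set_pmf not_not)
qed

text \<open>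
  The density of a coupling with respect to the product of its marginals integrates to \<open>1\<close> along
  every section over a value of positive probability.
\<close>

lemma nn_integral_coupling_density:
  assumes "pmf (map_pmf fst G) c \<noteq> 0"
  shows "(\<integral>\<^sup>+d. ennreal (pmf G (c, d) / (pmf (map_pmf fst G) c * pmf (map_pmf snd G) d))
            \<partial>measure_pmf (map_pmf snd G)) = 1"
proof -
  let ?p = "pmf (map_pmf fst G)" and ?q = "pmf (map_pmf snd G)"
  have p: "?p c > 0" using assms pmf_nonneg[of "map_pmf fst G" c] by linarith
  have "(\<integral>\<^sup>+d. ennreal (pmf G (c, d) / (?p c * ?q d)) \<partial>measure_pmf (map_pmf snd G))
      = (\<integral>\<^sup>+d. ennreal (1 / ?p c) * ennreal (pmf G (c, d)) \<partial>count_space UNIV)"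
    unfolding nn_integral_measure_pmf
  proof (intro nn_integral_cong)
    fix d
    show "ennreal (?q d) * ennreal (pmf G (c, d) / (?p c * ?q d))
        = ennreal (1 / ?p c) * ennreal (pmf G (c, d))"
      using p pmf_marginal_pos(2)[of G c d]
      by (cases "pmf G (c, d) = 0") (auto simp: ennreal_mult'[symmetric] field_simps)
  qed
  also have "\<dots> = ennreal (1 / ?p c) * emeasure G (range (Pair c))"
    by (subst nn_integral_cmult) (auto simp: nn_integral_pmf' inj_on_def)
  also have "range (Pair c) = fst -` {c}" by auto
  also have "emeasure G (fst -` {c}) = ennreal (?p c)"
    by (simp add: pmf_map measure_pmf.emeasure_eq_measure)
  finally show ?thesis using p by (simp add: ennreal_mult'[symmetric])
qed

text \<open>
  A coupling \<open>G\<close> of the discrete images \<open>Z1\<close> and \<open>Z2\<close> extends to a coupling of the spaces themselves.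
  Let \<open>w\<close> be the density of \<open>G\<close> with respect to the product of its marginals. The product
  measure with density \<open>w (Z1 x) (Z2 y)\<close> has the right joint law of \<open>Z1\<close> and \<open>Z2\<close>. It keeps both
  marginals since \<open>w\<close> integrates to \<open>1\<close> in each variable.
\<close>

lemma measure_with_marginals_and_discrete_coupling:
  fixes M1 :: "'a measure" and M2 :: "'b measure"
    and Z1 :: "'a \<Rightarrow> 'c::countable" and Z2 :: "'b \<Rightarrow> 'd::countable" and G :: "('c \<times> 'd) pmf"
  assumes "prob_space M1" "prob_space M2"
    and Z1[measurable]: "Z1 \<in> measurable M1 (count_space UNIV)"
    and Z2[measurable]: "Z2 \<in> measurable M2 (count_space UNIV)"
    and law1: "distr M1 (count_space UNIV) Z1 = measure_pmf (map_pmf fst G)"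
    and law2: "distr M2 (count_space UNIV) Z2 = measure_pmf (map_pmf snd G)"
  shows "\<exists>N. prob_space N \<and> sets N = sets (M1 \<Otimes>\<^sub>M M2) \<and> distr N M1 fst = M1 \<and> distr N M2 snd = M2 \<and>
    (\<forall>P. measure N {\<omega> \<in> space N. P (Z1 (fst \<omega>)) (Z2 (snd \<omega>))}
       = measure_pmf.prob G {(c, d). P c d})"
proof -
  interpret M1: prob_space M1 by fact
  interpret M2: prob_space M2 by fact
  interpret P: pair_prob_space M1 M2 ..
  define w where "w c d = ennreal (pmf G (c, d) / (pmf (map_pmf fst G) c * pmf (map_pmf snd G) d))" for c d
  define N where "N = density (M1 \<Otimes>\<^sub>M M2) (\<lambda>(x, y). w (Z1 x) (Z2 y))"
  have Zp: "(\<lambda>z. (Z1 (fst z), Z2 (snd z))) \<in> measurable (M1 \<Otimes>\<^sub>M M2) (count_space UNIV)"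
    by (intro measurable_count_space_Pair) measurable
  have meas: "(\<lambda>(x, y). f (Z1 x) (Z2 y)) \<in> borel_measurable (M1 \<Otimes>\<^sub>M M2)" for f :: "'c \<Rightarrow> 'd \<Rightarrow> ennreal"
    using measurable_compose[OF Zp, of "\<lambda>(c, d). f c d" borel] by (simp add: case_prod_unfold)
  have to_M1: "(\<integral>\<^sup>+c. f c \<partial>measure_pmf (map_pmf fst G)) = (\<integral>\<^sup>+x. f (Z1 x) \<partial>M1)" for f
    by (subst law1[symmetric]) (simp add: nn_integral_distr)
  have to_M2: "(\<integral>\<^sup>+d. f d \<partial>measure_pmf (map_pmf snd G)) = (\<integral>\<^sup>+y. f (Z2 y) \<partial>M2)" for f
    by (subst law2[symmetric]) (simp add: nn_integral_distr)
  have w1: "(\<integral>\<^sup>+y. w c (Z2 y) \<partial>M2) = 1" if "pmf (map_pmf fst G) c \<noteq> 0" for c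
    using nn_integral_coupling_density[OF that]
    unfolding to_M2 w_def .
  have w2: "(\<integral>\<^sup>+x. w (Z1 x) d \<partial>M1) = 1" if "pmf (map_pmf snd G) d \<noteq> 0" for d
  proof -
    define G' where "G' = map_pmf (\<lambda>(c, d). (d, c)) G"
    have m: "map_pmf fst G' = map_pmf snd G" "map_pmf snd G' = map_pmf fst G"
      by (simp_all add: G'_def map_pmf_comp case_prod_unfold)
    have "inj (\<lambda>(c :: 'c, d :: 'd). (d, c))" by (auto simp: inj_on_def)
    from pmf_map_inj'[OF this, of G "(c, d)" for c d]
    have g: "pmf G' (d, c) = pmf G (c, d)" for c d by (simp add: G'_def)
    from nn_integral_coupling_density[of G' d] that
    have "(\<integral>\<^sup>+c. w c d \<partial>measure_pmf (map_pmf fst G)) = 1"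
      unfolding m g w_def by (simp add: mult.commute)
    then show ?thesis unfolding to_M1 .
  qed
  have pos1: "AE x in M1. pmf (map_pmf fst G) (Z1 x) \<noteq> 0"
    by (rule AE_distrD[OF Z1]) (unfold law1 AE_measure_pmf_iff pmf_eq_0_set_pmf, blast)
  have pos2: "AE y in M2. pmf (map_pmf snd G) (Z2 y) \<noteq> 0"
    by (rule AE_distrD[OF Z2]) (unfold law2 AE_measure_pmf_iff pmf_eq_0_set_pmf, blast)
  have sets_N[measurable_cong]: "sets N = sets (M1 \<Otimes>\<^sub>M M2)" by (simp add: N_def)
  have space_N: "space N = space M1 \<times> space M2" by (simp add: N_def space_pair_measure)
  have m1: "distr N M1 fst = M1"
  proof (rule measure_eqI)
    fix A assume "A \<in> sets (distr N M1 fst)"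
    then have A[measurable]: "A \<in> sets M1" by simp
    have AA: "fst -` A \<inter> space N \<in> sets (M1 \<Otimes>\<^sub>M M2)"
      unfolding sets_N[symmetric] by measurable
    have "emeasure (distr N M1 fst) A = emeasure N (fst -` A \<inter> space N)"
      by (rule emeasure_distr) measurable
    also have "\<dots> = (\<integral>\<^sup>+z. (case z of (x, y) \<Rightarrow> w (Z1 x) (Z2 y)) * indicator (fst -` A \<inter> space N) z \<partial>(M1 \<Otimes>\<^sub>M M2))"
      unfolding N_def by (rule emeasure_density[OF meas]) (use AA in \<open>simp add: N_def\<close>)
    also have "\<dots> = (\<integral>\<^sup>+z. (case z of (x, y) \<Rightarrow> w (Z1 x) (Z2 y) * indicator A x) \<partial>(M1 \<Otimes>\<^sub>M M2))"
      by (intro nn_integral_cong) (auto simp: space_N space_pair_measure split: split_indicator)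
    also have "\<dots> = (\<integral>\<^sup>+x. \<integral>\<^sup>+y. w (Z1 x) (Z2 y) * indicator A x \<partial>M2 \<partial>M1)"
    proof -
      have [measurable]: "(\<lambda>z. w (Z1 (fst z)) (Z2 (snd z))) \<in> borel_measurable (M1 \<Otimes>\<^sub>M M2)"
        using meas by (simp add: case_prod_unfold)
      show ?thesis
        by (subst M2.nn_integral_fst[symmetric]) (simp_all add: case_prod_unfold)
    qed
    also have "\<dots> = (\<integral>\<^sup>+x. indicator A x \<partial>M1)"
      using pos1 by (intro nn_integral_cong_AE) (auto simp: w1 nn_integral_multc measurable_compose[OF Z2])
    finally show "emeasure (distr N M1 fst) A = emeasure M1 A" by simp
  qed simp
  have m2: "distr N M2 snd = M2"
  proof (rule measure_eqI)
    fix A assume "A \<in> sets (distr N M2 snd)"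
    then have A[measurable]: "A \<in> sets M2" by simp
    have AA: "snd -` A \<inter> space N \<in> sets (M1 \<Otimes>\<^sub>M M2)"
      unfolding sets_N[symmetric] by measurable
    have "emeasure (distr N M2 snd) A = emeasure N (snd -` A \<inter> space N)"
      by (rule emeasure_distr) measurable
    also have "\<dots> = (\<integral>\<^sup>+z. (case z of (x, y) \<Rightarrow> w (Z1 x) (Z2 y)) * indicator (snd -` A \<inter> space N) z \<partial>(M1 \<Otimes>\<^sub>M M2))"
      unfolding N_def by (rule emeasure_density[OF meas]) (use AA in \<open>simp add: N_def\<close>)
    also have "\<dots> = (\<integral>\<^sup>+z. (case z of (x, y) \<Rightarrow> w (Z1 x) (Z2 y) * indicator A y) \<partial>(M1 \<Otimes>\<^sub>M M2))"
      by (intro nn_integral_cong) (auto simp: space_N space_pair_measure split: split_indicator)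
    also have "\<dots> = (\<integral>\<^sup>+y. \<integral>\<^sup>+x. w (Z1 x) (Z2 y) * indicator A y \<partial>M1 \<partial>M2)"
    proof -
      have [measurable]: "(\<lambda>z. w (Z1 (fst z)) (Z2 (snd z))) \<in> borel_measurable (M1 \<Otimes>\<^sub>M M2)"
        using meas by (simp add: case_prod_unfold)
      show ?thesis
        by (subst P.nn_integral_snd[symmetric]) (simp_all add: case_prod_unfold)
    qed
    also have "\<dots> = (\<integral>\<^sup>+y. indicator A y \<partial>M2)"
      using pos2 by (intro nn_integral_cong_AE) (auto simp: w2 nn_integral_multc measurable_compose[OF Z1])
    finally show "emeasure (distr N M2 snd) A = emeasure M2 A" by simp
  qed simp
  have "prob_space (distr N M1 fst)" unfolding m1 by fact
  then have "prob_space N" by (rule prob_space_distrD[rotated]) measurable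
  then interpret N: prob_space N .
  have "measure N {\<omega> \<in> space N. P (Z1 (fst \<omega>)) (Z2 (snd \<omega>))} = measure_pmf.prob G {(c, d). P c d}" for P
  proof -
    let ?E = "{\<omega> \<in> space N. P (Z1 (fst \<omega>)) (Z2 (snd \<omega>))}"
    have "?E = (\<lambda>z. (Z1 (fst z), Z2 (snd z))) -` {(c, d). P c d} \<inter> space (M1 \<Otimes>\<^sub>M M2)"
      by (auto simp: N_def)
    with Zp have E: "?E \<in> sets (M1 \<Otimes>\<^sub>M M2)" by simp
    have "emeasure N ?E = (\<integral>\<^sup>+z. (case z of (x, y) \<Rightarrow> w (Z1 x) (Z2 y)) * indicator ?E z \<partial>(M1 \<Otimes>\<^sub>M M2))"
      unfolding N_def by (rule emeasure_density[OF meas]) (use E in \<open>simp add: N_def\<close>)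
    also have "\<dots> = (\<integral>\<^sup>+z. (case z of (x, y) \<Rightarrow> w (Z1 x) (Z2 y) * of_bool (P (Z1 x) (Z2 y))) \<partial>(M1 \<Otimes>\<^sub>M M2))"
      by (intro nn_integral_cong) (auto simp: N_def split: split_indicator)
    also have "\<dots> = (\<integral>\<^sup>+x. \<integral>\<^sup>+y. w (Z1 x) (Z2 y) * of_bool (P (Z1 x) (Z2 y)) \<partial>M2 \<partial>M1)"
      by (subst M2.nn_integral_fst[symmetric]) (simp_all add: meas[of "\<lambda>c d. w c d * of_bool (P c d)"])
    also have "\<dots> = (\<integral>\<^sup>+x. \<integral>\<^sup>+d. w (Z1 x) d * of_bool (P (Z1 x) d) \<partial>map_pmf snd G \<partial>M1)"
      by (simp only: to_M2)
    also have "\<dots> = (\<integral>\<^sup>+c. \<integral>\<^sup>+d. w c d * of_bool (P c d) \<partial>map_pmf snd G \<partial>map_pmf fst G)"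
      by (simp only: to_M1)
    also have "\<dots> = (\<integral>\<^sup>+c. \<integral>\<^sup>+d. ennreal (pmf G (c, d)) * of_bool (P c d) \<partial>count_space UNIV \<partial>count_space UNIV)"
      unfolding nn_integral_measure_pmf
    proof (intro nn_integral_cong)
      fix c
      let ?p = "pmf (map_pmf fst G)" and ?q = "pmf (map_pmf snd G)"
      have "ennreal (?p c) * (\<integral>\<^sup>+d. ennreal (?q d) * (w c d * of_bool (P c d)) \<partial>count_space UNIV)
         = (\<integral>\<^sup>+d. ennreal (?p c) * (ennreal (?q d) * (w c d * of_bool (P c d))) \<partial>count_space UNIV)"
        by (rule nn_integral_cmult[symmetric]) simp
      also have "\<dots> = (\<integral>\<^sup>+d. ennreal (pmf G (c, d)) * of_bool (P c d) \<partial>count_space UNIV)"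
      proof (intro nn_integral_cong)
        fix d
        have "ennreal (?p c) * (ennreal (?q d) * w c d) = pmf G (c, d)"
          using pmf_marginal_pos[of G c d] unfolding w_def
          by (cases "pmf G (c, d) = 0") (auto simp: ennreal_mult'[symmetric] field_simps)
        then show "ennreal (?p c) * (ennreal (?q d) * (w c d * of_bool (P c d))) = ennreal (pmf G (c, d)) * of_bool (P c d)"
          by (simp add: mult.assoc[symmetric])
      qed
      finally show "ennreal (?p c) * (\<integral>\<^sup>+d. ennreal (?q d) * (w c d * of_bool (P c d)) \<partial>count_space UNIV)
         = (\<integral>\<^sup>+d. ennreal (pmf G (c, d)) * of_bool (P c d) \<partial>count_space UNIV)" .
    qed
    also have "\<dots> = (\<integral>\<^sup>+z. ennreal (pmf G z) * indicator {(c, d). P c d} z \<partial>count_space UNIV)"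
      by (subst nn_integral_fst_count_space[symmetric]) (auto intro!: nn_integral_cong simp: indicator_def)
    also have "\<dots> = (\<integral>\<^sup>+z. indicator {(c, d). P c d} z \<partial>measure_pmf G)"
      by (simp add: nn_integral_measure_pmf)
    also have "\<dots> = emeasure G {(c, d). P c d}" by simp
    finally show ?thesis by (simp add: measure_def)
  qed
  then show ?thesis using \<open>prob_space N\<close> sets_N m1 m2 by blast
qed

section \<open>Dyadic cells and dependence coefficients\<close>

text \<open>
  The minimum puts the right end point \<open>a + r\<close> into the last cell. The ancestor at level \<open>l \<le> L\<close> of a
  cell \<open>j\<close> of level \<open>L\<close> is \<open>j div 2 ^ (L - l)\<close>.
\<close>

definition dyadic_cell :: "real \<Rightarrow> real \<Rightarrow> nat \<Rightarrow> real \<Rightarrow> nat" where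
  "dyadic_cell a r L x = min (nat \<lfloor>(x - a) / r * 2 ^ L\<rfloor>) (2 ^ L - 1)"

lemma dyadic_cell_less: "dyadic_cell a r L x < 2 ^ L"
proof -
  have "(0::nat) < 2 ^ L" by simp
  then show ?thesis unfolding dyadic_cell_def by linarith
qed

lemma measurable_dyadic_cell: "dyadic_cell a r L \<in> measurable borel (count_space UNIV)"
proof -
  have "(\<lambda>x::real. \<lfloor>(x - a) / r * 2 ^ L\<rfloor>) \<in> measurable borel (count_space UNIV)"
    by measurable
  from measurable_compose[OF this, of "\<lambda>n. min (nat n) (2 ^ L - 1)" "count_space UNIV"]
  show ?thesis unfolding dyadic_cell_def[abs_def] by simp
qed

lemma dyadic_cell_bounds:
  assumes "0 < r" "a \<le> x" "x \<le> a + r"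
  shows "real (dyadic_cell a r L x) \<le> (x - a) / r * 2 ^ L"
    and "(x - a) / r * 2 ^ L \<le> real (dyadic_cell a r L x) + 1"
proof -
  define s where "s = (x - a) / r * 2 ^ L"
  have s0: "0 \<le> s" using assms by (simp add: s_def)
  have "(x - a) / r \<le> 1" using assms by (simp add: field_simps)
  then have s1: "s \<le> 2 ^ L" unfolding s_def by (metis mult_left_le_one_le mult_right_mono mult_1 zero_le_power zero_le_numeral)
  define n where "n = nat \<lfloor>s\<rfloor>"
  have n: "real n \<le> s" "s \<le> real n + 1" using s0 unfolding n_def by linarith+
  have cell: "dyadic_cell a r L x = min n (2 ^ L - 1)"
    by (simp add: dyadic_cell_def n_def s_def)
  have top: "real (2 ^ L - 1) + 1 = 2 ^ L" by (simp add: of_nat_diff)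
  have "real (min n (2 ^ L - 1)) \<le> s \<and> s \<le> real (min n (2 ^ L - 1)) + 1"
  proof (cases "n \<le> 2 ^ L - 1")
    case True
    then show ?thesis using n by (simp add: min_absorb1)
  next
    case False
    then have least: "min n (2 ^ L - 1) = 2 ^ L - 1" by simp
    have "real (2 ^ L - 1) \<le> real n" using False by (simp only: of_nat_le_iff)
    then show ?thesis unfolding least using n s1 top by (intro conjI) linarith+
  qed
  then show "real (dyadic_cell a r L x) \<le> (x - a) / r * 2 ^ L"
    "(x - a) / r * 2 ^ L \<le> real (dyadic_cell a r L x) + 1"
    by (simp_all only: cell s_def)
qed

text \<open>
  After rescaling \<open>[a, a + r]\<close> to the unit interval, every point whose cell has the ancestor \<open>A\<close> at
  level \<open>l\<close> lies between \<open>A / 2 ^ l\<close> and \<open>(A + 1) / 2 ^ l\<close>.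
\<close>

lemma dist_le_of_same_ancestor:
  assumes "0 < r" "a \<le> x" "x \<le> a + r" "a \<le> y" "y \<le> a + r" "l \<le> L"
    and "dyadic_cell a r L x div 2 ^ (L - l) = dyadic_cell a r L y div 2 ^ (L - l)"
  shows "\<bar>x - y\<bar> \<le> r / 2 ^ l"
proof -
  define A where "A = dyadic_cell a r L x div 2 ^ (L - l)"
  have pw: "(2::real) ^ L = 2 ^ (L - l) * 2 ^ l" using assms(6) by (simp flip: power_add)
  have inA: "real A \<le> (z - a) / r * 2 ^ l \<and> (z - a) / r * 2 ^ l \<le> real A + 1"
    if z: "a \<le> z" "z \<le> a + r" "dyadic_cell a r L z div 2 ^ (L - l) = A" for z
  proof -
    have "A * 2 ^ (L - l) \<le> dyadic_cell a r L z"
      unfolding z(3)[symmetric] by (simp add: div_times_less_eq_dividend)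
    then have "real (A * 2 ^ (L - l)) \<le> real (dyadic_cell a r L z)"
      by (simp only: of_nat_le_iff)
    also have "\<dots> \<le> (z - a) / r * 2 ^ L" by (rule dyadic_cell_bounds(1)[OF assms(1) z(1,2)])
    finally have 1: "real A * 2 ^ (L - l) \<le> ((z - a) / r * 2 ^ l) * 2 ^ (L - l)"
      unfolding pw by (simp add: mult_ac)
    have "dyadic_cell a r L z + 1 \<le> (A + 1) * 2 ^ (L - l)"
      unfolding z(3)[symmetric] by (simp add: Suc_le_eq dividend_less_div_times)
    then have "real (dyadic_cell a r L z + 1) \<le> real ((A + 1) * 2 ^ (L - l))"
      by (simp only: of_nat_le_iff)
    with dyadic_cell_bounds(2)[OF assms(1) z(1,2), of L]
    have 2: "((z - a) / r * 2 ^ l) * 2 ^ (L - l) \<le> (real A + 1) * 2 ^ (L - l)"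
      unfolding pw by (simp add: algebra_simps)
    show ?thesis using mult_right_le_imp_le[OF 1] mult_right_le_imp_le[OF 2] by simp
  qed
  from inA[OF assms(2,3)] inA[OF assms(4,5)] assms(7)
  have "\<bar>(x - a) / r * 2 ^ l - (y - a) / r * 2 ^ l\<bar> \<le> 1" unfolding A_def by linarith
  also have "(x - a) / r * 2 ^ l - (y - a) / r * 2 ^ l = (x - y) * (2 ^ l / r)"
    using assms(1) by (simp add: field_simps)
  also have "\<bar>(x - y) * (2 ^ l / r)\<bar> = \<bar>x - y\<bar> * (2 ^ l / r)"
    using assms(1) by (simp add: abs_mult)
  finally show ?thesis using assms(1) by (simp add: field_simps)
qed

text \<open>
  The supremum is over a bounded set, since probabilities lie between \<open>0\<close> and \<open>1\<close>.
\<close>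

lemma alpha_coeff_upper:
  assumes "prob_space M" "B \<in> \<B>" "C \<in> \<C>"
  shows "\<bar>measure M (B \<inter> C) - measure M B * measure M C\<bar> \<le> alpha_coeff M \<B> \<C>"
proof -
  interpret prob_space M by fact
  have "\<bar>measure M (B \<inter> C) - measure M B * measure M C\<bar> \<le> 1" for B C
    using prob_le_1[of "B \<inter> C"] measure_nonneg[of M "B \<inter> C"]
      mult_le_one[OF prob_le_1[of B] measure_nonneg prob_le_1[of C]]
      mult_nonneg_nonneg[OF measure_nonneg[of M B] measure_nonneg[of M C]]
    unfolding abs_le_iff by linarith
  then have "bdd_above ((\<lambda>(B, C). \<bar>measure M (B \<inter> C) - measure M B * measure M C\<bar>) ` (\<B> \<times> \<C>))"
    by (intro bdd_aboveI2[of _ _ 1]) auto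
  from cSUP_upper[OF _ this, of "(B, C)"] show ?thesis
    using assms by (simp add: alpha_coeff_def)
qed

lemma empty_in_gen_sigma: "{} \<in> gen_sigma M X I"
  by (simp add: gen_sigma_def sigma_sets.Empty)

lemma alpha_coeff_gen_sigma_nonneg:
  assumes "prob_space M"
  shows "0 \<le> alpha_coeff M (gen_sigma M X I) (gen_sigma M X K)"
  using alpha_coeff_upper[OF assms empty_in_gen_sigma[of M X I] empty_in_gen_sigma[of M X K]] by simp

text \<open>
  The premise expresses that \<open>Z\<close> is measurable whenever the family is. This reduces membership in
  the generated \<open>\<sigma>\<close>-algebra to a measurability proof.
\<close>

lemma vimage_in_gen_sigma:
  assumes "\<And>F. space F = space M \<Longrightarrow> (\<And>i. i \<in> I \<Longrightarrow> X i \<in> borel_measurable F) \<Longrightarrow> Z \<in> measurable F (count_space UNIV)"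
  shows "Z -` S \<inter> space M \<in> gen_sigma M X I"
proof -
  define F where "F = sigma (space M) (\<Union>i\<in>I. {X i -` A \<inter> space M | A. A \<in> sets borel})"
  have gen: "(\<Union>i\<in>I. {X i -` A \<inter> space M | A. A \<in> sets borel}) \<subseteq> Pow (space M)" by auto
  have F: "space F = space M" "sets F = gen_sigma M X I"
    using gen by (simp_all add: F_def gen_sigma_def space_measure_of sets_measure_of)
  have "X i \<in> borel_measurable F" if "i \<in> I" for i
  proof (rule measurableI)
    fix A :: "real set" assume "A \<in> sets borel"
    then show "X i -` A \<inter> space F \<in> sets F"
      unfolding F gen_sigma_def using that by (intro sigma_sets.Basic) blast
  qed simp
  from measurable_sets[OF assms[OF F(1) this], of S] show ?thesis by (simp add: F)
qed

lemma gen_sigma_subset_space: "B \<in> gen_sigma M X I \<Longrightarrow> B \<subseteq> space M"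
  unfolding gen_sigma_def by (erule sigma_sets_into_sp[rotated]) auto

text \<open>
  The last variable in the order is compared with the trivial \<open>\<sigma>\<close>-algebra, so it contributes
  nothing.
\<close>

lemma alpha_coeff_gen_sigma_empty:
  assumes "prob_space M"
  shows "alpha_coeff M (gen_sigma M X I) (gen_sigma M X {}) = 0"
proof -
  interpret prob_space M by fact
  have triv: "gen_sigma M X {} = {{}, space M}"
    by (simp add: gen_sigma_def sigma_sets_empty_eq)
  have "measure M (B \<inter> C) - measure M B * measure M C = 0"
    if "B \<in> gen_sigma M X I" "C \<in> gen_sigma M X {}" for B C
    using that gen_sigma_subset_space[OF that(1)] by (auto simp: triv prob_space Int_absorb2)
  then have "(\<lambda>(B, C). \<bar>measure M (B \<inter> C) - measure M B * measure M C\<bar>)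
      ` (gen_sigma M X I \<times> gen_sigma M X {}) = {0}"
    using empty_in_gen_sigma[of M X I] empty_in_gen_sigma[of M X "{}"] by (auto simp: image_def)
  then show ?thesis by (simp add: alpha_coeff_def)
qed

text \<open>
  The list of the cells of all the variables is coupled with a list of independent cells. The
  latter has the law of the cells of a point \<open>y\<close> of the product space of the marginal laws, so the
  discrete coupling lifts to a coupling of \<open>M\<close> with that product, and the copy of \<open>X i\<close> is the
  coordinate \<open>y i\<close>. Two points at distance more than \<open>r / 2 ^ l\<close> have different ancestors at level \<open>l\<close>,
  where there are \<open>2 ^ l\<close> cells.
\<close>

lemma coupling_at_dyadic_scales:
  fixes M :: "'a measure" and X :: "nat \<Rightarrow> 'a \<Rightarrow> real"
  assumes "prob_space M" "k \<ge> 1" "0 < r"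
    and X: "\<And>i. i \<in> {1..k} \<Longrightarrow> X i \<in> borel_measurable M"
    and range: "\<And>i. i \<in> {1..k} \<Longrightarrow> AE \<omega> in M. a i \<le> X i \<omega> \<and> X i \<omega> \<le> a i + r"
  shows "\<exists>(N :: ('a \<times> (nat \<Rightarrow> real)) measure) Xs.
    enlargement N fst M \<and>
    (\<forall>i\<in>{1..k}. Xs i \<in> borel_measurable N \<and> distr N borel (Xs i) = distr M borel (X i)) \<and>
    prob_space.indep_vars N (\<lambda>_. borel) Xs {1..k} \<and>
    (\<forall>i\<in>{1..k}. \<forall>l\<le>L. measure N {\<omega> \<in> space N. \<bar>X i (fst \<omega>) - Xs i \<omega>\<bar> > r / 2 ^ l}
       \<le> 2 * sqrt 3 * sqrt (2 ^ l) * alpha_coeff M (gen_sigma M X {i}) (gen_sigma M X {i+1..k}))"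
proof -
  interpret M: prob_space M by fact
  define \<alpha> where "\<alpha> i = alpha_coeff M (gen_sigma M X {i}) (gen_sigma M X {i+1..k})" for i
  define cell where "cell i = dyadic_cell (a i) r L" for i
  define h :: "nat \<Rightarrow> nat \<Rightarrow> nat" where "h m j = j div 2 ^ m" for m j
  define D where "D i = distr M borel (X i)" for i
  define Q where "Q = PiM {1..k} D"
  define Z where "Z \<omega> = map (\<lambda>i. cell i (X i \<omega>)) [1..<Suc k]" for \<omega>
  define Zs where "Zs y = map (\<lambda>i. cell i (y i)) [1..<Suc k]" for y :: "nat \<Rightarrow> real"
  have cell: "cell i \<in> measurable borel (count_space UNIV)" for i
    unfolding cell_def by (rule measurable_dyadic_cell)
  have D: "prob_space (D i)" if "i \<in> {1..k}" for i
    unfolding D_def by (rule M.prob_space_distr[OF X[OF that]])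
  have prob_Q: "prob_space Q"
    unfolding Q_def by (rule prob_space_PiM[OF D])
  have Z: "Z \<in> measurable M (count_space UNIV)"
    unfolding Z_def using X
    by (intro measurable_count_space_map_list measurable_compose[OF _ cell]) auto
  have Zs: "Zs \<in> measurable Q (count_space UNIV)"
    unfolding Zs_def
  proof (intro measurable_count_space_map_list measurable_compose[OF _ cell])
    fix i assume "i \<in> set [1..<Suc k]"
    then have "(\<lambda>y. y i) \<in> measurable Q (D i)" unfolding Q_def by (intro measurable_component_singleton) auto
    then show "(\<lambda>y. y i) \<in> borel_measurable Q" by (simp add: D_def)
  qed
  obtain p where p: "measure_pmf p = distr M (count_space UNIV) Z"
    using law_as_pmf[OF assms(1) Z] by blast
  obtain q where q: "measure_pmf q = distr Q (count_space UNIV) Zs"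
    using law_as_pmf[OF prob_Q Zs] by blast
  have prob_p: "measure_pmf.prob p {z. P z} = measure M {\<omega> \<in> space M. P (Z \<omega>)}" for P
    using Z by (subst p) (simp add: measure_distr vimage_def Int_def conj_commute)
  have prob_q: "measure_pmf.prob q {z. P z} = measure Q {y \<in> space Q. P (Zs y)}" for P
    using Zs by (subst q) (simp add: measure_distr vimage_def Int_def conj_commute)
  have p_supp: "set_pmf p \<subseteq> {z. set z \<subseteq> {..<2 ^ L} \<and> length z = k}"
  proof -
    have "AE z in measure_pmf p. set z \<subseteq> {..<2 ^ L} \<and> length z = k"
      unfolding p using Z by (subst AE_distr_iff) (auto simp: Z_def cell_def dyadic_cell_less)
    then show ?thesis by (auto simp: AE_measure_pmf_iff)
  qed
  have Z_nth: "Z \<omega> ! i = cell (Suc i) (X (Suc i) \<omega>)" if "i < k" for \<omega> i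
    using that by (simp add: Z_def del: upt_Suc)
  have Z_drop: "drop n (Z \<omega>) = map (\<lambda>i. cell i (X i \<omega>)) [Suc n..<Suc k]" for \<omega> n
    by (simp add: Z_def drop_map del: upt_Suc)
  have p_alpha: "\<bar>measure_pmf.prob p {z. z ! i \<in> S \<and> drop (Suc i) z \<in> T}
      - measure_pmf.prob p {z. z ! i \<in> S} * measure_pmf.prob p {z. drop (Suc i) z \<in> T}\<bar> \<le> \<alpha> (Suc i)"
    if "i < k" for i S T
  proof -
    define B where "B = (\<lambda>\<omega>. cell (Suc i) (X (Suc i) \<omega>)) -` S \<inter> space M"
    define C where "C = (\<lambda>\<omega>. map (\<lambda>i. cell i (X i \<omega>)) [Suc (Suc i)..<Suc k]) -` T \<inter> space M"
    have "B \<in> gen_sigma M X {Suc i}"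
      unfolding B_def by (rule vimage_in_gen_sigma) (rule measurable_compose[OF _ cell], simp)
    moreover have "C \<in> gen_sigma M X {Suc i + 1..k}"
      unfolding C_def
      by (rule vimage_in_gen_sigma)
         (intro measurable_count_space_map_list measurable_compose[OF _ cell], auto)
    moreover have "measure_pmf.prob p {z. z ! i \<in> S \<and> drop (Suc i) z \<in> T} = measure M (B \<inter> C)"
      "measure_pmf.prob p {z. z ! i \<in> S} = measure M B"
      "measure_pmf.prob p {z. drop (Suc i) z \<in> T} = measure M C"
      unfolding prob_p Z_nth[OF that] Z_drop B_def C_def by (auto intro!: arg_cong[where f="measure M"])
    ultimately show ?thesis
      using alpha_coeff_upper[OF assms(1), of B _ C] by (simp add: \<alpha>_def)
  qed
  have coarser: "\<forall>m i j. h m i = h m j \<longrightarrow> h (Suc m) i = h (Suc m) j"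
    by (auto simp: h_def power_Suc2 div_mult2_eq simp del: power_Suc)
  have top: "h L i = h L j" if "i \<in> {..<2 ^ L}" "j \<in> {..<2 ^ L}" for i j
    using that by (simp add: h_def)
  obtain G where G: "map_pmf fst G = p"
    "\<And>z. pmf (map_pmf snd G) z
       = (if length z = k then \<Prod>i<k. pmf (map_pmf (\<lambda>z. z ! i) p) (z ! i) else 0)"
    "\<And>i m. i < k \<Longrightarrow> m \<le> L \<Longrightarrow> measure_pmf.prob G {(z, z'). h m (z ! i) \<noteq> h m (z' ! i)}
       \<le> 2 * sqrt 3 * sqrt (card (h m ` {..<2 ^ L})) * \<alpha> (Suc i)"
    using coupling_with_independent_list[OF finite_lessThan coarser top p_supp p_alpha] by blast
  have G_snd: "map_pmf snd G = q"
  proof (rule pmf_eqI)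
    fix z
    have qz: "pmf q z = measure Q {y \<in> space Q. Zs y = z}"
      using prob_q[of "\<lambda>z'. z' = z"] by (simp add: measure_pmf_single)
    show "pmf (map_pmf snd G) z = pmf q z"
    proof (cases "length z = k")
      case False
      then have none: "{y \<in> space Q. Zs y = z} = {}" by (auto simp: Zs_def)
      show ?thesis unfolding qz G(2) none using False by simp
    next
      case True
      define A where "A i = cell i -` {z ! (i - 1)}" for i
      have A: "A i \<in> sets (D i)" for i
        using measurable_sets[OF cell, of "{z ! (i - 1)}" i] by (simp add: A_def D_def)
      have "{y \<in> space Q. Zs y = z} = PiE {1..k} A"
      proof -
        have "Zs y = z \<longleftrightarrow> (\<forall>i\<in>{1..k}. y i \<in> A i)" for y
        proof -
          have "Zs y = z \<longleftrightarrow> (\<forall>i<k. cell (Suc i) (y (Suc i)) = z ! i)"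
            using True by (auto simp: list_eq_iff_nth_eq Zs_def simp del: upt_Suc)
          also have "\<dots> \<longleftrightarrow> (\<forall>i\<in>Suc ` {..<k}. y i \<in> A i)"
            by (auto simp: A_def)
          finally show ?thesis by (simp only: image_Suc_lessThan)
        qed
        then show ?thesis by (auto simp: Q_def space_PiM PiE_def D_def Pi_iff extensional_def)
      qed
      moreover have "emeasure Q (PiE {1..k} A) = (\<Prod>i\<in>{1..k}. ennreal (measure (D i) (A i)))"
      proof -
        define D' where "D' i = (if i \<in> {1..k} then D i else return borel 0)" for i
        interpret D': product_prob_space D'
          by (intro product_prob_spaceI) (auto simp: D'_def D prob_space_return)
        have QD': "Q = PiM {1..k} D'" unfolding Q_def by (intro PiM_cong) (auto simp: D'_def)
        have "emeasure Q (PiE {1..k} A) = (\<Prod>i\<in>{1..k}. emeasure (D' i) (A i))"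
          unfolding QD' by (rule D'.emeasure_PiM) (use A in \<open>auto simp: D'_def\<close>)
        also have "\<dots> = (\<Prod>i\<in>{1..k}. ennreal (measure (D i) (A i)))"
          using D by (intro prod.cong refl)
            (auto simp: D'_def finite_measure.emeasure_eq_measure prob_space.finite_measure)
        finally show ?thesis .
      qed
      ultimately have "pmf q z = (\<Prod>i\<in>{1..k}. measure (D i) (A i))"
        unfolding qz measure_def by (simp add: prod_ennreal prod_nonneg)
      also have "\<dots> = (\<Prod>i<k. measure (D (Suc i)) (A (Suc i)))"
        by (simp add: prod.atLeast1_atMost_eq)
      also have "\<dots> = (\<Prod>i<k. pmf (map_pmf (\<lambda>z. z ! i) p) (z ! i))"
      proof (intro prod.cong refl)
        fix i assume "i \<in> {..<k}"
        then have "i < k" by simp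
        have "pmf (map_pmf (\<lambda>z. z ! i) p) (z ! i) = measure_pmf.prob p {z'. z' ! i = z ! i}"
          by (simp add: pmf_map vimage_def)
        also have "\<dots> = measure M (X (Suc i) -` A (Suc i) \<inter> space M)"
          unfolding prob_p Z_nth[OF \<open>i < k\<close>] by (auto simp: A_def intro!: arg_cong[where f="measure M"])
        also have "\<dots> = measure (D (Suc i)) (A (Suc i))"
          unfolding D_def using X[of "Suc i"] A[of "Suc i"] \<open>i < k\<close>
          by (subst measure_distr) (auto simp: D_def)
        finally show "measure (D (Suc i)) (A (Suc i)) = pmf (map_pmf (\<lambda>z. z ! i) p) (z ! i)" ..
      qed
      finally show ?thesis using True by (simp add: G(2))
    qed
  qed
  obtain N where N: "prob_space N" "sets N = sets (M \<Otimes>\<^sub>M Q)" "distr N M fst = M" "distr N Q snd = Q"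
    "\<And>P. measure N {\<omega> \<in> space N. P (Z (fst \<omega>)) (Zs (snd \<omega>))} = measure_pmf.prob G {(c, d). P c d}"
    using measure_with_marginals_and_discrete_coupling[OF assms(1) prob_Q Z Zs, of G, unfolded G(1) G_snd, OF p[symmetric] q[symmetric]]
    by blast
  interpret N: prob_space N by fact
  have fst_N: "fst \<in> measurable N M" and snd_N: "snd \<in> measurable N Q"
    by (simp_all add: measurable_cong_sets[OF N(2) refl])
  define Xs where "Xs i \<omega> = snd \<omega> i" for i and \<omega> :: "'a \<times> (nat \<Rightarrow> real)"
  have comp: "(\<lambda>y. y i) \<in> measurable Q (D i)" if "i \<in> {1..k}" for i
    unfolding Q_def using that by (rule measurable_component_singleton)
  have Xs: "Xs i \<in> borel_measurable N" if "i \<in> {1..k}" for i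
    unfolding Xs_def using measurable_compose[OF snd_N comp[OF that]] by (simp add: D_def)
  have Xs_law: "distr N borel (Xs i) = D i" if "i \<in> {1..k}" for i
  proof -
    have "distr N borel (Xs i) = distr N (D i) (\<lambda>\<omega>. snd \<omega> i)"
      by (intro distr_cong) (auto simp: Xs_def D_def)
    also have "\<dots> = distr (distr N Q snd) (D i) (\<lambda>y. y i)"
      using snd_N comp[OF that] by (subst distr_distr) (auto simp: comp_def)
    also have "\<dots> = D i"
      unfolding N(4) unfolding Q_def using D that by (intro distr_PiM_component) auto
    finally show ?thesis .
  qed
  have "N.indep_vars (\<lambda>_. borel) Xs {1..k}"
  proof (subst N.indep_vars_iff_distr_eq_PiM')
    have "distr N (PiM {1..k} (\<lambda>_. borel)) (\<lambda>\<omega>. \<lambda>i\<in>{1..k}. Xs i \<omega>) = distr N Q snd"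
    proof (rule distr_cong[OF refl])
      show "sets (PiM {1..k} (\<lambda>_. borel)) = sets Q"
        unfolding Q_def by (intro sets_PiM_cong) (auto simp: D_def)
      fix \<omega> assume "\<omega> \<in> space N"
      then have "snd \<omega> \<in> space Q" using measurable_space[OF snd_N] by blast
      then show "(\<lambda>i\<in>{1..k}. Xs i \<omega>) = snd \<omega>"
        by (auto simp: Q_def space_PiM Xs_def PiE_def extensional_def restrict_def fun_eq_iff)
    qed
    also have "\<dots> = PiM {1..k} (\<lambda>i. distr N borel (Xs i))"
      unfolding N(4) unfolding Q_def using Xs_law by (intro PiM_cong) auto
    finally show "distr N (PiM {1..k} (\<lambda>_. borel)) (\<lambda>\<omega>. \<lambda>i\<in>{1..k}. Xs i \<omega>)
      = PiM {1..k} (\<lambda>i. distr N borel (Xs i))" .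
  qed (use assms(2) Xs in auto)
  moreover have "measure N {\<omega> \<in> space N. \<bar>X i (fst \<omega>) - Xs i \<omega>\<bar> > r / 2 ^ l}
       \<le> 2 * sqrt 3 * sqrt (2 ^ l) * \<alpha> i" if i: "i \<in> {1..k}" and l: "l \<le> L" for i l
  proof -
    obtain n where n: "i = Suc n" "n < k" using i by (cases i) auto
    let ?E = "{\<omega> \<in> space N. h (L - l) (Z (fst \<omega>) ! n) \<noteq> h (L - l) (Zs (snd \<omega>) ! n)}"
    have "AE \<omega> in N. a i \<le> X i (fst \<omega>) \<and> X i (fst \<omega>) \<le> a i + r"
      by (rule AE_distrD[OF fst_N]) (unfold N(3), rule range[OF i])
    moreover have "AE \<omega> in N. a i \<le> Xs i \<omega> \<and> Xs i \<omega> \<le> a i + r"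
    proof (rule AE_distrD[OF Xs[OF i]])
      show "AE x in distr N borel (Xs i). a i \<le> x \<and> x \<le> a i + r"
        unfolding Xs_law[OF i] D_def using X[OF i] range[OF i] by (subst AE_distr_iff) auto
    qed
    ultimately have "AE \<omega> in N. \<omega> \<in> {\<omega> \<in> space N. \<bar>X i (fst \<omega>) - Xs i \<omega>\<bar> > r / 2 ^ l} \<longrightarrow> \<omega> \<in> ?E"
    proof eventually_elim
      case (elim \<omega>)
      have "Z (fst \<omega>) ! n = cell i (X i (fst \<omega>))" "Zs (snd \<omega>) ! n = cell i (Xs i \<omega>)"
        using n by (simp_all add: Z_nth Zs_def Xs_def del: upt_Suc)
      then show ?case
        using dist_le_of_same_ancestor[OF assms(3) _ _ _ _ l, of "a i" "X i (fst \<omega>)" "Xs i \<omega>"] elim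
        by (auto simp: h_def cell_def)
    qed
    moreover have "?E \<in> sets N"
    proof -
      have "(\<lambda>\<omega>. (Z (fst \<omega>), Zs (snd \<omega>))) \<in> measurable N (count_space UNIV)"
        by (intro measurable_count_space_Pair measurable_compose[OF fst_N Z] measurable_compose[OF snd_N Zs])
      from measurable_sets[OF this, of "{(z, z'). h (L - l) (z ! n) \<noteq> h (L - l) (z' ! n)}"]
      show ?thesis by (simp add: vimage_def Int_def conj_commute)
    qed
    ultimately have "measure N {\<omega> \<in> space N. \<bar>X i (fst \<omega>) - Xs i \<omega>\<bar> > r / 2 ^ l} \<le> measure N ?E"
      by (rule N.finite_measure_mono_AE)
    also have "\<dots> = measure_pmf.prob G {(z, z'). h (L - l) (z ! n) \<noteq> h (L - l) (z' ! n)}"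
      by (rule N(5))
    also have "\<dots> \<le> 2 * sqrt 3 * sqrt (card (h (L - l) ` {..<2 ^ L})) * \<alpha> i"
      unfolding n(1) by (rule G(3)) (use n in auto)
    also have "\<dots> \<le> 2 * sqrt 3 * sqrt (2 ^ l) * \<alpha> i"
    proof -
      have "h (L - l) ` {..<2 ^ L} \<subseteq> {..<2 ^ l}"
      proof -
        have "(2::nat) ^ L = 2 ^ l * 2 ^ (L - l)" using l by (simp flip: power_add)
        then show ?thesis by (auto simp: h_def less_mult_imp_div_less)
      qed
      then have "card (h (L - l) ` {..<2 ^ L}) \<le> card {..<(2::nat) ^ l}" by (intro card_mono) auto
      then have "real (card (h (L - l) ` {..<2 ^ L})) \<le> 2 ^ l"
        by (metis card_lessThan of_nat_le_iff of_nat_numeral of_nat_power)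
      moreover have "0 \<le> \<alpha> i" unfolding \<alpha>_def by (rule alpha_coeff_gen_sigma_nonneg[OF assms(1)])
      ultimately show ?thesis by (intro mult_right_mono mult_left_mono) auto
    qed
    finally show ?thesis .
  qed
  ultimately show ?thesis
    using N(1,3) fst_N Xs Xs_law unfolding enlargement_def \<alpha>_def D_def
    by (intro exI[of _ N] exI[of _ Xs]) auto
qed

section \<open>Vanishing dependence\<close>

text \<open>
  If every variable is independent of the later ones, the probability of a box factorizes one
  coordinate at a time, starting from the last.
\<close>

lemma indep_vars_of_alpha_zero:
  fixes X :: "nat \<Rightarrow> 'a \<Rightarrow> real"
  assumes "prob_space M" "k \<ge> 1"
    and X: "\<And>i. i \<in> {1..k} \<Longrightarrow> X i \<in> borel_measurable M"
    and zero: "\<And>i. i \<in> {1..<k} \<Longrightarrow>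
      alpha_coeff M (gen_sigma M X {i}) (gen_sigma M X {i+1..k}) = 0"
  shows "prob_space.indep_vars M (\<lambda>_. borel) X {1..k}"
proof -
  interpret M: prob_space M by fact
  define D where "D i = (if i \<in> {1..k} then distr M borel (X i) else return borel 0)" for i
  interpret D: product_prob_space D
    by (intro product_prob_spaceI) (auto simp: D_def M.prob_space_distr X prob_space_return)
  have sets_D: "sets (D i) = sets borel" for i by (simp add: D_def)
  have "distr M (PiM {1..k} (\<lambda>_. borel)) (\<lambda>\<omega>. \<lambda>i\<in>{1..k}. X i \<omega>) = PiM {1..k} D"
  proof (rule D.PiM_eqI)
    show "sets (distr M (PiM {1..k} (\<lambda>_. borel)) (\<lambda>\<omega>. \<lambda>i\<in>{1..k}. X i \<omega>)) = sets (PiM {1..k} D)"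
      unfolding sets_distr by (intro sets_PiM_cong) (auto simp: sets_D)
    fix A assume "\<And>i. i \<in> {1..k} \<Longrightarrow> A i \<in> sets (D i)"
    then have A: "A i \<in> sets borel" if "i \<in> {1..k}" for i using that by (simp add: sets_D)
    have tail: "measure M {\<omega> \<in> space M. \<forall>i\<in>{m..k}. X i \<omega> \<in> A i}
        = (\<Prod>i\<in>{m..k}. measure M {\<omega> \<in> space M. X i \<omega> \<in> A i})" if "m \<le> k" "1 \<le> m" for m
      using that
    proof (induction m rule: inc_induct)
      case base
      then show ?case by simp
    next
      case (step n)
      define B where "B = {\<omega> \<in> space M. X n \<omega> \<in> A n}"
      define C where "C = {\<omega> \<in> space M. \<forall>i\<in>{Suc n..k}. X i \<omega> \<in> A i}"
      have split: "{n..k} = insert n {Suc n..k}" using step by auto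
      have "B \<in> gen_sigma M X {n}"
      proof -
        have "(\<lambda>\<omega>. X n \<omega> \<in> A n) -` {True} \<inter> space M \<in> gen_sigma M X {n}"
        proof (rule vimage_in_gen_sigma)
          fix F :: "'a measure" assume "\<And>i. i \<in> {n} \<Longrightarrow> X i \<in> borel_measurable F"
          then have [measurable]: "X n \<in> borel_measurable F" by simp
          have [measurable]: "A n \<in> sets borel" using A step by simp
          show "(\<lambda>\<omega>. X n \<omega> \<in> A n) \<in> measurable F (count_space UNIV)" by measurable
        qed
        then show ?thesis by (simp add: B_def vimage_def Int_def conj_commute)
      qed
      moreover have "C \<in> gen_sigma M X {n+1..k}"
      proof -
        have "(\<lambda>\<omega>. \<forall>i\<in>{Suc n..k}. X i \<omega> \<in> A i) -` {True} \<inter> space M \<in> gen_sigma M X {n+1..k}"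
        proof (rule vimage_in_gen_sigma)
          fix F :: "'a measure" assume XF: "\<And>i. i \<in> {n+1..k} \<Longrightarrow> X i \<in> borel_measurable F"
          have "(\<lambda>\<omega>. X i \<omega> \<in> A i) \<in> measurable F (count_space UNIV)" if "i \<in> {Suc n..k}" for i
          proof -
            have [measurable]: "X i \<in> borel_measurable F" "A i \<in> sets borel"
              using that XF A step by auto
            show ?thesis by measurable
          qed
          then show "(\<lambda>\<omega>. \<forall>i\<in>{Suc n..k}. X i \<omega> \<in> A i) \<in> measurable F (count_space UNIV)"
            by (intro pred_intros_finite) auto
        qed
        then show ?thesis by (simp add: C_def vimage_def Int_def conj_commute)
      qed
      ultimately have "measure M (B \<inter> C) = measure M B * measure M C"
        using alpha_coeff_upper[OF assms(1), of B _ C] zero[of n] step by fastforce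
      moreover have "B \<inter> C = {\<omega> \<in> space M. \<forall>i\<in>{n..k}. X i \<omega> \<in> A i}"
        unfolding split by (auto simp: B_def C_def)
      ultimately show ?case using step.IH step.prems by (simp add: split B_def C_def)
    qed
    have restr: "(\<lambda>\<omega>. \<lambda>i\<in>{1..k}. X i \<omega>) \<in> measurable M (PiM {1..k} (\<lambda>_. borel))"
      using X by (intro measurable_restrict) auto
    have "emeasure (distr M (PiM {1..k} (\<lambda>_. borel)) (\<lambda>\<omega>. \<lambda>i\<in>{1..k}. X i \<omega>)) (PiE {1..k} A)
        = emeasure M ((\<lambda>\<omega>. \<lambda>i\<in>{1..k}. X i \<omega>) -` PiE {1..k} A \<inter> space M)"
      using restr A by (intro emeasure_distr sets_PiM_I_finite) auto
    also have "(\<lambda>\<omega>. \<lambda>i\<in>{1..k}. X i \<omega>) -` PiE {1..k} A \<inter> space M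
        = {\<omega> \<in> space M. \<forall>i\<in>{1..k}. X i \<omega> \<in> A i}"
      by (auto simp: PiE_iff)
    also have "emeasure M {\<omega> \<in> space M. \<forall>i\<in>{1..k}. X i \<omega> \<in> A i}
        = (\<Prod>i\<in>{1..k}. ennreal (measure M {\<omega> \<in> space M. X i \<omega> \<in> A i}))"
      using tail[of 1] assms(2) by (simp add: M.emeasure_eq_measure prod_ennreal)
    also have "\<dots> = (\<Prod>i\<in>{1..k}. emeasure (D i) (A i))"
    proof (intro prod.cong refl)
      fix i assume i: "i \<in> {1..k}"
      have "emeasure (D i) (A i) = emeasure M (X i -` A i \<inter> space M)"
        using i X A by (simp add: D_def emeasure_distr)
      then show "ennreal (measure M {\<omega> \<in> space M. X i \<omega> \<in> A i}) = emeasure (D i) (A i)"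
        by (simp add: M.emeasure_eq_measure vimage_def Int_def conj_commute)
    qed
    finally show "emeasure (distr M (PiM {1..k} (\<lambda>_. borel)) (\<lambda>\<omega>. \<lambda>i\<in>{1..k}. X i \<omega>)) (PiE {1..k} A)
        = (\<Prod>i\<in>{1..k}. emeasure (D i) (A i))" .
  qed simp
  also have "\<dots> = PiM {1..k} (\<lambda>i. distr M borel (X i))"
    by (intro PiM_cong) (auto simp: D_def)
  finally show ?thesis
    using assms(2) X by (subst M.indep_vars_iff_distr_eq_PiM') auto
qed

text \<open>
  The copies are the variables themselves. They are recorded in the second component by the
  embedding \<open>\<omega> \<mapsto> (\<omega>, X \<omega>)\<close>.
\<close>

lemma trivial_coupling:
  fixes M :: "'a measure" and X :: "nat \<Rightarrow> 'a \<Rightarrow> real"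
  assumes "prob_space M" "k \<ge> 1"
    and X: "\<And>i. i \<in> {1..k} \<Longrightarrow> X i \<in> borel_measurable M"
    and indep: "prob_space.indep_vars M (\<lambda>_. borel) X {1..k}"
  shows "\<exists>(N :: ('a \<times> (nat \<Rightarrow> real)) measure) Xs.
    enlargement N fst M \<and>
    (\<forall>i\<in>{1..k}. Xs i \<in> borel_measurable N \<and> distr N borel (Xs i) = distr M borel (X i)) \<and>
    prob_space.indep_vars N (\<lambda>_. borel) Xs {1..k} \<and>
    (AE \<omega> in N. \<forall>i\<in>{1..k}. X i (fst \<omega>) = Xs i \<omega>)"
proof -
  interpret M: prob_space M by fact
  define P where "P = M \<Otimes>\<^sub>M PiM {1..k} (\<lambda>_. borel :: real measure)"
  define e where "e \<omega> = (\<omega>, \<lambda>i\<in>{1..k}. X i \<omega>)" for \<omega>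
  define N where "N = distr M P e"
  define Xs where "Xs i \<omega> = snd \<omega> i" for i and \<omega> :: "'a \<times> (nat \<Rightarrow> real)"
  have e: "e \<in> measurable M P"
    unfolding e_def P_def using X by (intro measurable_Pair measurable_restrict) auto
  interpret N: prob_space N unfolding N_def by (rule M.prob_space_distr[OF e])
  have Xs_P: "Xs i \<in> borel_measurable P" if "i \<in> {1..k}" for i
    unfolding Xs_def P_def using that
    by (intro measurable_compose[OF measurable_snd measurable_component_singleton])
  have Xs: "Xs i \<in> borel_measurable N" if "i \<in> {1..k}" for i
    using Xs_P[OF that] by (simp add: N_def)
  have Xs_e: "Xs i (e \<omega>) = X i \<omega>" if "i \<in> {1..k}" for i \<omega>
    using that by (simp add: Xs_def e_def)
  have law: "distr N borel (Xs i) = distr M borel (X i)" if "i \<in> {1..k}" for i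
    unfolding N_def using e Xs_P[OF that] Xs_e[OF that]
    by (subst distr_distr) (auto intro!: distr_cong)
  have fst_P: "fst \<in> measurable P M" unfolding P_def by (rule measurable_fst)
  have fst: "distr N M fst = M"
  proof -
    have "distr N M fst = distr M M (fst \<circ> e)" unfolding N_def by (rule distr_distr[OF fst_P e])
    also have "fst \<circ> e = (\<lambda>\<omega>. \<omega>)" by (auto simp: e_def)
    finally show ?thesis by simp
  qed
  have "distr N (PiM {1..k} (\<lambda>_. borel)) (\<lambda>\<omega>. \<lambda>i\<in>{1..k}. Xs i \<omega>)
      = distr M (PiM {1..k} (\<lambda>_. borel)) ((\<lambda>\<omega>. \<lambda>i\<in>{1..k}. Xs i \<omega>) \<circ> e)"
    unfolding N_def using Xs_P by (intro distr_distr e measurable_restrict)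
  also have "(\<lambda>\<omega>. \<lambda>i\<in>{1..k}. Xs i \<omega>) \<circ> e = (\<lambda>\<omega>. \<lambda>i\<in>{1..k}. X i \<omega>)"
    using Xs_e by (auto simp: fun_eq_iff)
  also have "distr M (PiM {1..k} (\<lambda>_. borel)) (\<lambda>\<omega>. \<lambda>i\<in>{1..k}. X i \<omega>)
      = PiM {1..k} (\<lambda>i. distr M borel (X i))"
    using M.indep_vars_iff_distr_eq_PiM'[of "{1..k}" X "\<lambda>_. borel"] X indep assms(2) by auto
  also have "\<dots> = PiM {1..k} (\<lambda>i. distr N borel (Xs i))"
    by (intro PiM_cong refl) (simp add: law)
  finally have law_joint: "distr N (PiM {1..k} (\<lambda>_. borel)) (\<lambda>\<omega>. \<lambda>i\<in>{1..k}. Xs i \<omega>)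
      = PiM {1..k} (\<lambda>i. distr N borel (Xs i))" .
  have "N.indep_vars (\<lambda>_. borel) Xs {1..k}"
  proof (subst N.indep_vars_iff_distr_eq_PiM')
    show "distr N (PiM {1..k} (\<lambda>_. borel)) (\<lambda>\<omega>. \<lambda>i\<in>{1..k}. Xs i \<omega>)
      = PiM {1..k} (\<lambda>i. distr N borel (Xs i))" by (rule law_joint)
  qed (use assms(2) Xs in auto)
  moreover have "AE \<omega> in N. \<forall>i\<in>{1..k}. X i (fst \<omega>) = Xs i \<omega>"
  proof -
    have "{\<omega> \<in> space P. X i (fst \<omega>) = Xs i \<omega>} \<in> sets P" if "i \<in> {1..k}" for i
      by (intro borel_measurable_eq measurable_compose[OF fst_P X[OF that]] Xs_P[OF that])
    then have "{\<omega> \<in> space P. \<forall>i\<in>{1..k}. X i (fst \<omega>) = Xs i \<omega>} \<in> sets P"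
      using assms(2) by (intro sets.sets_Collect_finite_All') auto
    then show ?thesis
      unfolding N_def by (subst AE_distr_iff[OF e]) (simp_all add: Xs_e, simp add: e_def)
  qed
  moreover have "enlargement N fst M"
    unfolding enlargement_def using N.prob_space_axioms fst fst_P by (simp add: N_def)
  ultimately show ?thesis
    using Xs law by (intro exI[of _ N] exI[of _ Xs]) auto
qed

section \<open>The bound at all thresholds\<close>

lemma (in prob_space) indep_vars_reindex:
  assumes "inj_on f I" "indep_vars (\<lambda>_. N) X (f ` I)"
  shows "indep_vars (\<lambda>_. N) (\<lambda>i. X (f i)) I"
proof -
  from assms(2) have rv: "\<forall>i\<in>f ` I. random_variable N (X i)"
    and ind: "indep_sets (\<lambda>i. {X i -` A \<inter> space M | A. A \<in> sets N}) (f ` I)"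
    by (auto simp: indep_vars_def2)
  have "indep_sets (\<lambda>i. {X (f i) -` A \<inter> space M | A. A \<in> sets N}) I"
  proof (rule indep_setsI)
    fix i assume "i \<in> I"
    then show "{X (f i) -` A \<inter> space M | A. A \<in> sets N} \<subseteq> events"
      using rv by (auto intro: measurable_sets)
  next
    fix A J assume J: "J \<noteq> {}" "J \<subseteq> I" "finite J"
      and A: "\<forall>j\<in>J. A j \<in> {X (f j) -` B \<inter> space M | B. B \<in> sets N}"
    define A' where "A' = A \<circ> inv_into J f"
    have inj: "inj_on f J" using assms(1) J(2) by (rule inj_on_subset)
    have A': "A' (f j) = A j" if "j \<in> J" for j
      using inj that by (simp add: A'_def)
    have "prob (\<Inter>j\<in>f ` J. A' j) = (\<Prod>j\<in>f ` J. prob (A' j))"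
    proof (rule indep_setsD[OF ind])
      show "\<forall>j\<in>f ` J. A' j \<in> {X j -` B \<inter> space M | B. B \<in> sets N}"
      proof
        fix j assume "j \<in> f ` J"
        then obtain n where n: "n \<in> J" "j = f n" by auto
        then show "A' j \<in> {X j -` B \<inter> space M | B. B \<in> sets N}" using A A'[of n] by simp
      qed
    qed (use J in auto)
    then show "prob (\<Inter>j\<in>J. A j) = (\<Prod>j\<in>J. prob (A j))"
      using A' by (simp add: prod.reindex[OF inj])
  qed
  then show ?thesis using rv by (simp add: indep_vars_def2)
qed

lemma average_bounds:
  fixes f :: "nat \<Rightarrow> real"
  assumes "k \<ge> 1" "\<And>i. i \<in> {1..k} \<Longrightarrow> f i \<le> c"
  shows "(1 / real k) * (\<Sum>i = 1..k. f i) \<le> c"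
proof -
  have "(\<Sum>i = 1..k. f i) \<le> (\<Sum>i = 1..k. c)" by (intro sum_mono assms(2))
  then show ?thesis using assms(1) by (simp add: field_simps)
qed

text \<open>
  The interesting thresholds are those with \<open>t < r\<close> and \<open>18 * S * sqrt (r / t) < 1\<close>: for \<open>t \<ge> r\<close>
  the average almost surely does not exceed \<open>t\<close>, and without the second inequality the bound is trivial. The second
  condition bounds \<open>r / t\<close> by a constant depending on \<open>S\<close> only, so finitely many scales suffice. If \<open>l\<close> is
  the least level with \<open>r / 2 ^ l \<le> t\<close>, then \<open>2 ^ l \<le> 2 * (r / t)\<close>, and the
  union bound over \<open>i\<close> gives \<open>2 * sqrt 3 * sqrt (2 * r / t) * S\<close>.
\<close>

lemma coupling_in_given_order:
  fixes M :: "'a measure" and X :: "nat \<Rightarrow> 'a \<Rightarrow> real"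
  assumes "prob_space M" "k \<ge> 1" "0 \<le> r"
    and X: "\<And>i. i \<in> {1..k} \<Longrightarrow> X i \<in> borel_measurable M"
    and range: "\<And>i. i \<in> {1..k} \<Longrightarrow> AE \<omega> in M. a i \<le> X i \<omega> \<and> X i \<omega> \<le> a i + r"
    and S: "S = (\<Sum>i = 1..<k. alpha_coeff M (gen_sigma M X {i}) (gen_sigma M X {i+1..k}))"
  shows "\<exists>(N :: ('a \<times> (nat \<Rightarrow> real)) measure) Xs.
    enlargement N fst M \<and>
    (\<forall>i\<in>{1..k}. Xs i \<in> borel_measurable N \<and> distr N borel (Xs i) = distr M borel (X i)) \<and>
    prob_space.indep_vars N (\<lambda>_. borel) Xs {1..k} \<and>
    (\<forall>t::real. t > 0 \<longrightarrow>
       measure N {\<omega> \<in> space N. (1 / real k) * (\<Sum>i = 1..k. \<bar>X i (fst \<omega>) - Xs i \<omega>\<bar>) > t}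
         \<le> 18 * S * sqrt (r / t))"
proof -
  define \<alpha> where "\<alpha> i = alpha_coeff M (gen_sigma M X {i}) (gen_sigma M X {i+1..k})" for i
  have \<alpha>: "0 \<le> \<alpha> i" for i
    unfolding \<alpha>_def by (rule alpha_coeff_gen_sigma_nonneg[OF assms(1)])
  have S_sum: "S = (\<Sum>i = 1..<k. \<alpha> i)" by (simp add: S \<alpha>_def)
  have "\<alpha> k = 0" unfolding \<alpha>_def using alpha_coeff_gen_sigma_empty[OF assms(1)] by simp
  moreover have "{1..k} = insert k {1..<k}" using assms(2) by auto
  ultimately have S_all: "(\<Sum>i = 1..k. \<alpha> i) = S" by (simp add: S_sum)
  have S0: "0 \<le> S" unfolding S_sum by (intro sum_nonneg \<alpha>)
  show ?thesis
  proof (cases "S = 0")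
    case True
    then have "alpha_coeff M (gen_sigma M X {i}) (gen_sigma M X {i+1..k}) = 0" if "i \<in> {1..<k}" for i
      using that \<alpha> unfolding S_sum \<alpha>_def[symmetric] by (subst (asm) sum_nonneg_eq_0_iff) auto
    from trivial_coupling[of M k X, OF assms(1,2) X indep_vars_of_alpha_zero[of M k X, OF assms(1,2) X this]]
    obtain N :: "('a \<times> (nat \<Rightarrow> real)) measure" and Xs where N: "enlargement N fst M"
      "\<forall>i\<in>{1..k}. Xs i \<in> borel_measurable N \<and> distr N borel (Xs i) = distr M borel (X i)"
      "prob_space.indep_vars N (\<lambda>_. borel) Xs {1..k}"
      "AE \<omega> in N. \<forall>i\<in>{1..k}. X i (fst \<omega>) = Xs i \<omega>"
      by blast
    interpret N: prob_space N using N(1) by (simp add: enlargement_def)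
    have "measure N {\<omega> \<in> space N. (1 / real k) * (\<Sum>i = 1..k. \<bar>X i (fst \<omega>) - Xs i \<omega>\<bar>) > t} \<le> 0"
      if "t > 0" for t
    proof -
      have "AE \<omega> in N. \<omega> \<in> {\<omega> \<in> space N. (1 / real k) * (\<Sum>i = 1..k. \<bar>X i (fst \<omega>) - Xs i \<omega>\<bar>) > t}
          \<longrightarrow> \<omega> \<in> {}"
        using N(4)
      proof eventually_elim
        case (elim \<omega>)
        then have "(\<Sum>i = 1..k. \<bar>X i (fst \<omega>) - Xs i \<omega>\<bar>) = 0" by (intro sum.neutral) auto
        then show ?case using that by simp
      qed
      from N.finite_measure_mono_AE[OF this] show ?thesis by simp
    qed
    with N(1-3) True show ?thesis by (intro exI[of _ N] exI[of _ Xs]) simp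
  next
    case False
    with S0 have "0 < S" by simp
    \<comment> \<open>The cells need positive length. If \<open>r = 0\<close>, every \<open>t > 0\<close> falls into the case \<open>r \<le> t\<close>, so any \<open>R > 0\<close> will do.\<close>
    define R where "R = (if r = 0 then 1 else r)"
    have R: "0 < R" "r \<le> R" using assms(3) by (auto simp: R_def)
    \<comment> \<open>\<open>324 = 18^2\<close>: levels up to \<open>L\<close> reach all thresholds at which the bound is below \<open>1\<close>.\<close>
    obtain L where L: "1 / (324 * S^2) < 2 ^ L" using real_arch_pow[of 2] by auto
    have "AE \<omega> in M. a i \<le> X i \<omega> \<and> X i \<omega> \<le> a i + R" if "i \<in> {1..k}" for i
      using range[OF that] by eventually_elim (use R in auto)
    from coupling_at_dyadic_scales[of M k R X a L, OF assms(1,2) R(1) X this, folded \<alpha>_def]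
    obtain N :: "('a \<times> (nat \<Rightarrow> real)) measure" and Xs where N: "enlargement N fst M"
      "\<forall>i\<in>{1..k}. Xs i \<in> borel_measurable N \<and> distr N borel (Xs i) = distr M borel (X i)"
      "prob_space.indep_vars N (\<lambda>_. borel) Xs {1..k}"
      "\<And>i l. i \<in> {1..k} \<Longrightarrow> l \<le> L \<Longrightarrow>
        measure N {\<omega> \<in> space N. \<bar>X i (fst \<omega>) - Xs i \<omega>\<bar> > R / 2 ^ l} \<le> 2 * sqrt 3 * sqrt (2 ^ l) * \<alpha> i"
      by blast
    interpret N: prob_space N using N(1) by (simp add: enlargement_def)
    have fst_N: "fst \<in> measurable N M" "distr N M fst = M" using N(1) by (auto simp: enlargement_def)
    have Xs: "Xs i \<in> borel_measurable N" if "i \<in> {1..k}" for i using N(2) that by blast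
    have Xfst: "(\<lambda>\<omega>. X i (fst \<omega>)) \<in> borel_measurable N" if "i \<in> {1..k}" for i
      by (rule measurable_compose[OF fst_N(1) X[OF that]])
    define E where "E t = {\<omega> \<in> space N. (1 / real k) * (\<Sum>i = 1..k. \<bar>X i (fst \<omega>) - Xs i \<omega>\<bar>) > t}" for t
    have "measure N (E t) \<le> 18 * S * sqrt (r / t)" if "t > 0" for t
    proof (cases "r \<le> t")
      case True
      have "AE \<omega> in N. \<bar>X i (fst \<omega>) - Xs i \<omega>\<bar> \<le> r" if i: "i \<in> {1..k}" for i
      proof -
        have "AE \<omega> in N. a i \<le> X i (fst \<omega>) \<and> X i (fst \<omega>) \<le> a i + r"
          by (rule AE_distrD[OF fst_N(1)]) (unfold fst_N(2), rule range[OF i])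
        moreover have "AE \<omega> in N. a i \<le> Xs i \<omega> \<and> Xs i \<omega> \<le> a i + r"
        proof (rule AE_distrD[OF Xs[OF i]])
          show "AE x in distr N borel (Xs i). a i \<le> x \<and> x \<le> a i + r"
            unfolding N(2)[rule_format, OF i, THEN conjunct2]
            using X[OF i] range[OF i] by (subst AE_distr_iff) auto
        qed
        ultimately show ?thesis by eventually_elim auto
      qed
      then have "AE \<omega> in N. \<forall>i\<in>{1..k}. \<bar>X i (fst \<omega>) - Xs i \<omega>\<bar> \<le> r"
        by (intro AE_finite_allI) auto
      then have "AE \<omega> in N. \<omega> \<in> E t \<longrightarrow> \<omega> \<in> {}"
      proof eventually_elim
        case (elim \<omega>)
        then have "(1 / real k) * (\<Sum>i = 1..k. \<bar>X i (fst \<omega>) - Xs i \<omega>\<bar>) \<le> r"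
          by (intro average_bounds assms(2)) blast
        then show ?case using True by (auto simp: E_def)
      qed
      from N.finite_measure_mono_AE[OF this] have "measure N (E t) \<le> 0" by simp
      also have "0 \<le> 18 * S * sqrt (r / t)" using S0 assms(3) \<open>t > 0\<close> by simp
      finally show ?thesis .
    next
      case False
      then have "R = r" "0 < r" using \<open>t > 0\<close> by (auto simp: R_def)
      define u where "u = r / t"
      have u: "1 < u" using False \<open>t > 0\<close> by (simp add: u_def)
      show ?thesis
      proof (cases "1 \<le> 18 * S * sqrt u")
        case True
        then show ?thesis using N.prob_le_1[of "E t"] unfolding u_def by linarith
      next
        case small: False
        have "(18 * S * sqrt u)^2 < 1"
          using small S0 u by (simp add: power_less_one_iff abs_square_less_1[unfolded abs_of_nonneg])
        then have "324 * S^2 * u < 1" using u by (simp add: power_mult_distrib)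
        then have "u < 1 / (324 * S^2)" using \<open>0 < S\<close> by (simp add: field_simps)
        with L have uL: "u \<le> 2 ^ L" by simp
        define l where "l = (LEAST l. u \<le> 2 ^ l)"
        have l: "u \<le> 2 ^ l" unfolding l_def using uL by (rule LeastI)
        have "l \<le> L" unfolding l_def using uL by (rule Least_le)
        have "l \<noteq> 0" using l u by (auto intro: gr0I)
        then obtain l' where l': "l = Suc l'" by (cases l) auto
        have "\<not> u \<le> 2 ^ l'" using not_less_Least[of l' "\<lambda>l. u \<le> 2 ^ l"] l' by (simp add: l_def)
        then have l2: "2 ^ l \<le> 2 * u" by (simp add: l')
        have scale: "R / 2 ^ l \<le> t"
          using l \<open>t > 0\<close> unfolding u_def \<open>R = r\<close> by (simp add: field_simps)
        let ?B = "\<lambda>i. {\<omega> \<in> space N. \<bar>X i (fst \<omega>) - Xs i \<omega>\<bar> > R / 2 ^ l}"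
        have B: "?B i \<in> sets N" if "i \<in> {1..k}" for i
        proof -
          note [measurable] = Xfst[OF that] Xs[OF that]
          show ?thesis by measurable
        qed
        have "E t \<subseteq> (\<Union>i\<in>{1..k}. ?B i)"
        proof
          fix \<omega> assume \<omega>: "\<omega> \<in> E t"
          have "\<exists>i\<in>{1..k}. \<bar>X i (fst \<omega>) - Xs i \<omega>\<bar> > R / 2 ^ l"
          proof (rule ccontr)
            assume "\<not> ?thesis"
            then have "(1 / real k) * (\<Sum>i = 1..k. \<bar>X i (fst \<omega>) - Xs i \<omega>\<bar>) \<le> R / 2 ^ l"
              by (intro average_bounds assms(2)) (auto simp: not_less)
            then show False using \<omega> scale by (simp add: E_def)
          qed
          then show "\<omega> \<in> (\<Union>i\<in>{1..k}. ?B i)" using \<omega> by (auto simp: E_def)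
        qed
        then have "measure N (E t) \<le> measure N (\<Union>i\<in>{1..k}. ?B i)"
          using B by (intro N.finite_measure_mono) auto
        also have "\<dots> \<le> (\<Sum>i = 1..k. measure N (?B i))"
          using B by (intro N.finite_measure_subadditive_finite) auto
        also have "\<dots> \<le> (\<Sum>i = 1..k. 2 * sqrt 3 * sqrt (2 ^ l) * \<alpha> i)"
          using \<open>l \<le> L\<close> by (intro sum_mono N(4)) auto
        also have "\<dots> = 2 * sqrt 3 * sqrt (2 ^ l) * S"
          by (simp only: sum_distrib_left[symmetric] S_all)
        also have "\<dots> \<le> 2 * 2 * (2 * sqrt u) * S"
        proof -
          have "sqrt 3 \<le> 2" by (rule real_le_lsqrt) auto
          moreover have "sqrt (2 ^ l) \<le> 2 * sqrt u"
            using l2 u by (intro real_le_lsqrt) (auto simp: power_mult_distrib)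
          ultimately show ?thesis using S0 by (intro mult_right_mono mult_mono) auto
        qed
        also have "\<dots> \<le> 18 * S * sqrt u" using S0 u by simp
        finally show ?thesis by (simp add: u_def)
      qed
    qed
    then show ?thesis using N(1-3) unfolding E_def by (intro exI[of _ N] exI[of _ Xs]) blast
  qed
qed

lemma alpha_sep_attained:
  assumes "k \<ge> 1"
  obtains \<pi> where "\<pi> permutes {1..k}"
    "real k * alpha_sep M k X
      = (\<Sum>i = 1..<k. alpha_coeff M (gen_sigma M X {\<pi> i}) (gen_sigma M X (\<pi> ` {i+1..k})))"
proof -
  let ?f = "\<lambda>\<pi>. (1 / real k) * (\<Sum>i = 1..<k.
      alpha_coeff M (gen_sigma M X {\<pi> i}) (gen_sigma M X (\<pi> ` {i+1..k})))"
  let ?P = "{\<pi>. \<pi> permutes {1..k}}"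
  have "finite ?P" by (intro finite_permutations) auto
  moreover have "?P \<noteq> {}" using permutes_id by blast
  ultimately have "Min (?f ` ?P) \<in> ?f ` ?P" by (intro Min_in) auto
  then obtain \<pi> where "\<pi> permutes {1..k}" "alpha_sep M k X = ?f \<pi>"
    by (auto simp: alpha_sep_def)
  then show ?thesis using assms by (intro that[of \<pi>]) auto
qed

lemma gen_sigma_reindex: "gen_sigma M (\<lambda>i. X (f i)) I = gen_sigma M X (f ` I)"
  by (simp add: gen_sigma_def)

theorem theorem1:
  fixes M :: "'a measure" and k :: nat
    and X :: "nat \<Rightarrow> 'a \<Rightarrow> real" and a b :: "nat \<Rightarrow> real"
  assumes "prob_space M"
    and "k \<ge> 1"
    and "\<And>i. i \<in> {1..k} \<Longrightarrow> X i \<in> borel_measurable M"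
    and "\<And>i. i \<in> {1..k} \<Longrightarrow> a i \<le> b i"
    and "\<And>i. i \<in> {1..k} \<Longrightarrow> AE \<omega> in M. a i \<le> X i \<omega> \<and> X i \<omega> \<le> b i"
  shows "\<exists>(N :: ('a \<times> (nat \<Rightarrow> real)) measure) Xs.
           enlargement N fst M \<and>
           (\<forall>i\<in>{1..k}. Xs i \<in> borel_measurable N \<and>
                        distr N borel (Xs i) = distr M borel (X i)) \<and>
           prob_space.indep_vars N (\<lambda>_. borel) Xs {1..k} \<and>
           (\<forall>t::real. t > 0 \<longrightarrow>
              measure N {\<omega> \<in> space N. (1 / real k) * (\<Sum>i = 1..k. \<bar>X i (fst \<omega>) - Xs i \<omega>\<bar>) > t}
                \<le> 18 * real k * alpha_sep M k X * sqrt ((MAX i\<in>{1..k}. \<bar>b i - a i\<bar>) / t))"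
proof -
  define r where "r = (MAX i\<in>{1..k}. \<bar>b i - a i\<bar>)"
  have r: "\<bar>b i - a i\<bar> \<le> r" if "i \<in> {1..k}" for i
    unfolding r_def using that by (intro Max_ge) auto
  have r0: "0 \<le> r" using r[of 1] assms(2) by force
  obtain \<pi> where \<pi>: "\<pi> permutes {1..k}" and sep: "real k * alpha_sep M k X
      = (\<Sum>i = 1..<k. alpha_coeff M (gen_sigma M X {\<pi> i}) (gen_sigma M X (\<pi> ` {i+1..k})))"
    by (rule alpha_sep_attained[OF assms(2)])
  \<comment> \<open>In the order given by \<open>\<pi>\<close>, the directed coefficients add up to \<open>real k * alpha_sep M k X\<close>.\<close>
  define Y where "Y i = X (\<pi> i)" for i
  have \<pi>_in: "\<pi> i \<in> {1..k}" if "i \<in> {1..k}" for i using permutes_in_image[OF \<pi>] that by blast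
  have inv_in: "inv \<pi> i \<in> {1..k}" if "i \<in> {1..k}" for i
    using permutes_in_image[OF permutes_inv[OF \<pi>]] that by blast
  have range: "AE \<omega> in M. a (\<pi> i) \<le> Y i \<omega> \<and> Y i \<omega> \<le> a (\<pi> i) + r" if "i \<in> {1..k}" for i
    using assms(5)[OF \<pi>_in[OF that]]
    by eventually_elim (use r[OF \<pi>_in[OF that]] in \<open>auto simp: Y_def\<close>)
  have Y: "Y i \<in> borel_measurable M" if "i \<in> {1..k}" for i
    unfolding Y_def by (rule assms(3)[OF \<pi>_in[OF that]])
  have sep_Y: "real k * alpha_sep M k X
      = (\<Sum>i = 1..<k. alpha_coeff M (gen_sigma M Y {i}) (gen_sigma M Y {i+1..k}))"
    unfolding sep Y_def gen_sigma_reindex by simp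
  from coupling_in_given_order[of M k r Y "\<lambda>i. a (\<pi> i)", OF assms(1,2) r0 Y range sep_Y]
  obtain N :: "('a \<times> (nat \<Rightarrow> real)) measure" and Ys where N: "enlargement N fst M"
    "\<forall>i\<in>{1..k}. Ys i \<in> borel_measurable N \<and> distr N borel (Ys i) = distr M borel (Y i)"
    "prob_space.indep_vars N (\<lambda>_. borel) Ys {1..k}"
    "\<forall>t::real. t > 0 \<longrightarrow>
       measure N {\<omega> \<in> space N. (1 / real k) * (\<Sum>i = 1..k. \<bar>Y i (fst \<omega>) - Ys i \<omega>\<bar>) > t}
         \<le> 18 * (real k * alpha_sep M k X) * sqrt (r / t)"
    by blast
  interpret N: prob_space N using N(1) by (simp add: enlargement_def)
  define Xs where "Xs i = Ys (inv \<pi> i)" for i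
  have "Xs i \<in> borel_measurable N \<and> distr N borel (Xs i) = distr M borel (X i)" if "i \<in> {1..k}" for i
    using N(2) inv_in[OF that] permutes_inverses(1)[OF \<pi>] by (simp add: Xs_def Y_def)
  moreover have "N.indep_vars (\<lambda>_. borel) Xs {1..k}"
    unfolding Xs_def
  proof (rule N.indep_vars_reindex)
    show "inj_on (inv \<pi>) {1..k}" by (rule permutes_inj_on[OF permutes_inv[OF \<pi>]])
    show "N.indep_vars (\<lambda>_. borel) Ys (inv \<pi> ` {1..k})"
      using N(3) by (simp only: permutes_image[OF permutes_inv[OF \<pi>]])
  qed
  moreover have "(\<Sum>i = 1..k. \<bar>X i (fst \<omega>) - Xs i \<omega>\<bar>) = (\<Sum>i = 1..k. \<bar>Y i (fst \<omega>) - Ys i \<omega>\<bar>)" for \<omega>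
    using sum.permute[OF \<pi>, of "\<lambda>i. \<bar>X i (fst \<omega>) - Xs i \<omega>\<bar>"] permutes_inverses(2)[OF \<pi>]
    by (simp add: Xs_def Y_def)
  ultimately show ?thesis
    using N(1,4) unfolding r_def[symmetric]
    by (intro exI[of _ N] exI[of _ Xs]) (simp add: mult.assoc)
qed

end
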